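(* Let $d$ be a positive integer and let $\tilde{X}(d)=\{(z_0,z_1)\in\mathbb{S}^3:z_0^d+z_1^d=0\}\subseteq\mathbb{S}^3\subset\mathbb{C}^2$ (the case $n=1$). Then the cut locus of $\tilde{X}(d)$ in $\mathbb{S}^3$ is $$\mathrm{Cu}(\tilde{X}(d))=(\mathbb{Z}_d\star\mathbb{Z}_d)\times_{\mathbb{Z}_d}\mathbb{S}^1.$$
   Context: $\mathbb{S}^3$ is the unit sphere in $\mathbb{C}^2$ with the round metric. The set $\tilde{X}(d)$ is the preimage, under the quotient map $\mathbb{S}^3\to\mathbb{CP}^1$, $(z_0,z_1)\mapsto[z_0:z_1]$, of the degree $d$ Fermat hypersurface $X(d)=\{[z_0:z_1]:z_0^d+z_1^d=0\}$. $\mathbb{Z}_d\subset\mathbb{S}^1$ is the group of $d$-th roots of unity, and $\star$ is the topological join, realized in $\mathbb{S}^3$ as $\mathbb{Z}_d\star\mathbb{Z}_d=\{(\xi^k\cos\phi,\xi^l\sin\phi):0\le k,l\le d-1,\ 0\le\phi\le\pi/2\}$ with $\xi=e^{2\pi\sqrt{-1}/d}$. $\times_{\mathbb{Z}_d}$ denotes the quotient of the product by the diagonal action of $\mathbb{Z}_d$, and $(\mathbb{Z}_d\star\mathbb{Z}_d)\times_{\mathbb{Z}_d}\mathbb{S}^1$ is regarded as a subset of $\mathbb{S}^3$ via the map induced by $(\mathbf{v},e^{\sqrt{-1}\theta})\mapsto\mathbf{v}e^{-\sqrt{-1}\theta}$. A distance minimal geodesic joining a closed submanifold $N$ of a Riemannian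 manifold $M$ to $q\in M$ is a geodesic starting at a point of $N$ and ending at $q$ whose length equals $d(N,q)=\inf_{x\in N}d(x,q)$, where $d(\cdot,\cdot)$ is the Riemannian distance. The cut locus $\mathrm{Cu}(N)$ is the set of points $q\in M$ for which there is a distance minimal geodesic joining $N$ to $q$ such that any extension of it beyond $q$ is not a distance minimal geodesic.
   Formalization: The formal theorem assumes d ≥ 2 instead of d a positive integer: for d = 1 the claim fails, since (1,0) lies in the right-hand side but its unique minimal geodesic from the great circle X̃(1) extends minimally beyond it. *)

theory Defs
  imports "HOL-Analysis.Analysis"
begin

(* Here M is an embedded submanifold of a Euclidean space, with the Riemannian metric
   induced by the ambient inner product. *)

definition tangent_space :: "'a::euclidean_space set \<Rightarrow> 'a \<Rightarrow> 'a set" where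
  "tangent_space M p =
     {v. \<exists>c::real \<Rightarrow> 'a. c 0 = p \<and> (\<forall>\<^sub>F t in nhds 0. c t \<in> M)
            \<and> (c has_vector_derivative v) (at 0)}"

(* Requiring has_integral excludes curves of infinite length, to which
   integral would assign the junk value 0. *)
definition has_length :: "(real \<Rightarrow> 'a::euclidean_space) \<Rightarrow> real \<Rightarrow> real \<Rightarrow> real \<Rightarrow> bool" where
  "has_length c a b L \<longleftrightarrow>
     ((\<lambda>t. norm (vector_derivative c (at t within {a..b}))) has_integral L) {a..b}"

definition riemannian_dist :: "'a::euclidean_space set \<Rightarrow> 'a \<Rightarrow> 'a \<Rightarrow> real" where
  "riemannian_dist M p q =
     Inf {L. \<exists>c. valid_path c \<and> path_image c \<subseteq> M \<and> pathstart c = p \<and> pathfinish c = q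
               \<and> has_length c 0 1 L}"

definition riemannian_setdist :: "'a::euclidean_space set \<Rightarrow> 'a set \<Rightarrow> 'a \<Rightarrow> real" where
  "riemannian_setdist M N q = (INF x\<in>N. riemannian_dist M x q)"

(* Unit speed geodesics on {0..l}.  The Levi-Civita connection of the induced metric is the
   tangential part of the ambient derivative, so the geodesic equation says that the
   acceleration is normal to M.  The case l = 0 is allowed and gives the point c 0, without
   a preferred direction. *)
definition geodesic :: "'a::euclidean_space set \<Rightarrow> (real \<Rightarrow> 'a) \<Rightarrow> real \<Rightarrow> bool" where
  "geodesic M c l \<longleftrightarrow> 0 \<le> l \<and>
     (\<exists>v a. \<forall>t\<in>{0..l}. c t \<in> M
        \<and> (c has_vector_derivative v t) (at t within {0..l})
        \<and> (v has_vector_derivative a t) (at t within {0..l})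
        \<and> norm (v t) = 1
        \<and> (\<forall>w\<in>tangent_space M (c t). a t \<bullet> w = 0))"

definition dist_minimal_geodesic ::
    "'a::euclidean_space set \<Rightarrow> 'a set \<Rightarrow> 'a \<Rightarrow> (real \<Rightarrow> 'a) \<Rightarrow> real \<Rightarrow> bool" where
  "dist_minimal_geodesic M N q c l \<longleftrightarrow>
     geodesic M c l \<and> c 0 \<in> N \<and> c l = q \<and> has_length c 0 l (riemannian_setdist M N q)"

(* Only the values of c on {0..l} matter; an extension of it beyond q = c l is a geodesic
   on a longer interval {0..m} that agrees with c on {0..l}. *)
definition cut_locus :: "'a::euclidean_space set \<Rightarrow> 'a set \<Rightarrow> 'a set" where
  "cut_locus M N =
     {q\<in>M. \<exists>c l. dist_minimal_geodesic M N q c l \<and>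
        (\<forall>e m. l < m \<and> geodesic M e m \<and> (\<forall>t\<in>{0..l}. e t = c t)
            \<longrightarrow> \<not> dist_minimal_geodesic M N (e m) e m)}"

(* The inner product of the type complex \<times> complex is the real part of the standard
   Hermitian product. *)
definition S3 :: "(complex \<times> complex) set" where
  "S3 = sphere 0 1"

definition fermat_link :: "nat \<Rightarrow> (complex \<times> complex) set" where
  "fermat_link d = {(z0, z1). (z0, z1) \<in> S3 \<and> z0 ^ d + z1 ^ d = 0}"

definition unit_roots :: "nat \<Rightarrow> complex set" where
  "unit_roots d = {\<zeta>. \<zeta> ^ d = 1}"

definition unit_roots_join :: "nat \<Rightarrow> (complex \<times> complex) set" where
  "unit_roots_join d =
     {(\<xi> ^ k * of_real (cos \<phi>), \<xi> ^ l * of_real (sin \<phi>)) | \<xi> k l \<phi>.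
        \<xi> = exp (2 * of_real pi * \<i> / of_nat d) \<and> k < d \<and> l < d \<and> 0 \<le> \<phi> \<and> \<phi> \<le> pi / 2}"

definition scal :: "complex \<Rightarrow> complex \<times> complex \<Rightarrow> complex \<times> complex" where
  "scal w z = (w * fst z, w * snd z)"

definition diagonal_orbit_rel ::
    "nat \<Rightarrow> (complex \<times> complex) set \<Rightarrow> (((complex \<times> complex) \<times> complex) \<times> ((complex \<times> complex) \<times> complex)) set" where
  "diagonal_orbit_rel d A =
     {((x, w), (y, u)). (x, w) \<in> A \<times> sphere 0 1 \<and> (y, u) \<in> A \<times> sphere 0 1
        \<and> (\<exists>\<zeta>\<in>unit_roots d. y = scal \<zeta> x \<and> u = \<zeta> * w)}"

definition twisted_product ::
    "nat \<Rightarrow> (complex \<times> complex) set \<Rightarrow> ((complex \<times> complex) \<times> complex) set set" where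
  "twisted_product d A = (A \<times> sphere 0 1) // diagonal_orbit_rel d A"

definition twist :: "(complex \<times> complex) \<times> complex \<Rightarrow> complex \<times> complex" where
  "twist = (\<lambda>(x, w). scal (inverse w) x)"

(* twist is constant on each orbit (lemma induced_twist_class), so the_elem picks its value. *)
definition induced_twist :: "((complex \<times> complex) \<times> complex) set \<Rightarrow> complex \<times> complex" where
  "induced_twist C = the_elem (twist ` C)"

lemma induced_twist_class:
  assumes d: "d > 0" and xw: "(x, w) \<in> A \<times> sphere 0 1"
  shows "induced_twist (diagonal_orbit_rel d A `` {(x, w)}) = twist (x, w)"
proof -
  let ?C = "diagonal_orbit_rel d A `` {(x, w)}"
  have "(1::complex) \<in> unit_roots d" by (simp add: unit_roots_def)
  then have "(x, w) \<in> ?C"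
    using xw by (force simp: diagonal_orbit_rel_def scal_def intro!: bexI[of _ 1])
  moreover have "twist p = twist (x, w)" if p: "p \<in> ?C" for p
  proof -
    obtain \<zeta> where z: "\<zeta> ^ d = 1" "p = (scal \<zeta> x, \<zeta> * w)"
      using p by (cases p) (auto simp: diagonal_orbit_rel_def unit_roots_def)
    then have "\<zeta> \<noteq> 0" using d by (auto simp: power_0_left)
    then show ?thesis using z by (simp add: twist_def scal_def)
  qed
  ultimately have "twist ` ?C = {twist (x, w)}" by blast
  then show ?thesis by (simp add: induced_twist_def)
qed

lemma unit_roots_join_rotate:
  assumes d: "d > 0" and x: "x \<in> unit_roots_join d" and y: "y \<in> unit_roots_join d"
    and w: "norm w = 1" and eq: "y = scal w x"
  shows "w \<in> unit_roots d"
proof -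
  let ?\<xi> = "exp (2 * of_real pi * \<i> / of_nat d) :: complex"
  have xi: "?\<xi> ^ d = 1"
    using d by (simp add: exp_of_nat_mult[symmetric] mult.commute)
  then have xik: "(?\<xi> ^ k) ^ d = 1" for k
    by (metis power_mult mult.commute power_one)
  have nn: "r = s \<and> (r = 0 \<or> w ^ d = 1)"
    if "0 \<le> r" "0 \<le> s" "w * (?\<xi> ^ k * of_real r) = ?\<xi> ^ l * of_real s" for r s :: real and k l
  proof -
    have "norm (w * (?\<xi> ^ k * of_real r)) = norm (?\<xi> ^ l * of_real s)" using that by simp
    then have rs: "r = s" using that(1,2) w by (simp add: norm_mult norm_power norm_exp_eq_Re)
    have "w ^ d = 1" if r0: "r \<noteq> 0"
    proof -
      have "w * ?\<xi> ^ k = ?\<xi> ^ l"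
        using \<open>w * (?\<xi> ^ k * of_real r) = ?\<xi> ^ l * of_real s\<close> rs r0
        by (simp add: mult.assoc[symmetric])
      then have "(w * ?\<xi> ^ k) ^ d = 1" by (simp add: xik)
      then show ?thesis by (simp add: power_mult_distrib xik)
    qed
    then show ?thesis using rs by blast
  qed
  obtain k l \<phi> where X: "x = (?\<xi> ^ k * of_real (cos \<phi>), ?\<xi> ^ l * of_real (sin \<phi>))"
    "0 \<le> \<phi>" "\<phi> \<le> pi / 2" using x unfolding unit_roots_join_def by blast
  obtain k' l' \<psi> where Y: "y = (?\<xi> ^ k' * of_real (cos \<psi>), ?\<xi> ^ l' * of_real (sin \<psi>))"
    "0 \<le> \<psi>" "\<psi> \<le> pi / 2" using y unfolding unit_roots_join_def by blast
  have pos: "0 \<le> cos \<phi>" "0 \<le> sin \<phi>" "0 \<le> cos \<psi>" "0 \<le> sin \<psi>"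
    using X Y by (auto intro!: cos_ge_zero sin_ge_zero)
  have "cos \<phi> = 0 \<or> w ^ d = 1" "sin \<phi> = 0 \<or> w ^ d = 1"
    using nn[OF pos(1) pos(3), of k k'] nn[OF pos(2) pos(4), of l l'] eq X(1) Y(1)
    by (auto simp: scal_def)
  moreover have "cos \<phi> \<noteq> 0 \<or> sin \<phi> \<noteq> 0"
    by (metis sin_cos_squared_add power_zero_numeral add.right_neutral zero_neq_one)
  ultimately show ?thesis by (auto simp: unit_roots_def)
qed

(* This justifies regarding the twisted product of the join as a subset of the sphere. *)
lemma inj_on_induced_twist:
  assumes d: "d > 0"
  shows "inj_on induced_twist (twisted_product d (unit_roots_join d))"
proof (rule inj_onI)
  let ?J = "unit_roots_join d"
  let ?R = "diagonal_orbit_rel d ?J"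
  fix C D assume C: "C \<in> twisted_product d ?J" and D: "D \<in> twisted_product d ?J"
    and eq: "induced_twist C = induced_twist D"
  obtain x w where xw: "(x, w) \<in> ?J \<times> sphere 0 1" "C = ?R `` {(x, w)}"
    using C by (auto simp: twisted_product_def quotient_def)
  obtain y u where yu: "(y, u) \<in> ?J \<times> sphere 0 1" "D = ?R `` {(y, u)}"
    using D by (auto simp: twisted_product_def quotient_def)
  have n: "norm w = 1" "norm u = 1" "w \<noteq> 0" "u \<noteq> 0" using xw yu by auto
  have "scal (inverse w) x = scal (inverse u) y"
    using eq xw yu induced_twist_class[OF d] by (simp add: twist_def)
  then have y: "y = scal (u / w) x"
    using n by (auto simp: scal_def prod_eq_iff field_simps)
  have "norm (u / w) = 1" using n by (simp add: norm_divide)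
  then have z: "u / w \<in> unit_roots d"
    using unit_roots_join_rotate[OF d _ _ _ y] xw yu by auto
  define \<zeta> where "\<zeta> = u / w"
  have \<zeta>: "\<zeta> \<in> unit_roots d" "\<zeta> \<noteq> 0" "y = scal \<zeta> x" "u = \<zeta> * w"
    using z y n by (auto simp: \<zeta>_def)
  have grp: "\<alpha> * \<beta> \<in> unit_roots d" "inverse \<alpha> \<in> unit_roots d"
    if "\<alpha> \<in> unit_roots d" "\<beta> \<in> unit_roots d" for \<alpha> \<beta>
    using that by (auto simp: unit_roots_def power_mult_distrib power_inverse)
  have "((x, w), p) \<in> ?R \<longleftrightarrow> ((y, u), p) \<in> ?R" for p
  proof -
    obtain p1 p2 where p: "p = (p1, p2)" by fastforce
    have "(\<exists>\<alpha>\<in>unit_roots d. p1 = scal \<alpha> x \<and> p2 = \<alpha> * w) \<longleftrightarrow>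
          (\<exists>\<alpha>\<in>unit_roots d. p1 = scal \<alpha> y \<and> p2 = \<alpha> * u)"
    proof
      assume "\<exists>\<alpha>\<in>unit_roots d. p1 = scal \<alpha> x \<and> p2 = \<alpha> * w"
      then obtain \<alpha> where "\<alpha> \<in> unit_roots d" "p1 = scal \<alpha> x" "p2 = \<alpha> * w" by blast
      then show "\<exists>\<alpha>\<in>unit_roots d. p1 = scal \<alpha> y \<and> p2 = \<alpha> * u"
        using \<zeta> grp by (intro bexI[of _ "\<alpha> * inverse \<zeta>"]) (auto simp: scal_def)
    next
      assume "\<exists>\<alpha>\<in>unit_roots d. p1 = scal \<alpha> y \<and> p2 = \<alpha> * u"
      then obtain \<alpha> where "\<alpha> \<in> unit_roots d" "p1 = scal \<alpha> y" "p2 = \<alpha> * u" by blast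
      then show "\<exists>\<alpha>\<in>unit_roots d. p1 = scal \<alpha> x \<and> p2 = \<alpha> * w"
        using \<zeta> grp by (intro bexI[of _ "\<alpha> * \<zeta>"]) (auto simp: scal_def)
    qed
    then show ?thesis using xw yu by (auto simp: p diagonal_orbit_rel_def)
  qed
  then show "C = D" using xw yu by auto
qed

end

theory Submission
  imports Defs
begin

text \<open>On the sphere the distance is the angle and geodesics are great circles, so a unit speed arc of length
  \<open>l \<le> pi\<close> from \<open>N\<close> to \<open>q\<close> is minimal iff \<open>x \<bullet> q \<le> cos l\<close> for all \<open>x\<close> in \<open>N\<close>, and a point with two nearest
  points in \<open>N\<close> is a cut point. The link is a union of \<open>d\<close> Hopf circles, one for each \<open>\<eta>\<close> with \<open>\<eta> ^ d = - 1\<close>; with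
  \<open>z = q\<^sub>0 * cnj q\<^sub>1\<close> the squared cosine of the distance from \<open>q\<close> to the circle of \<open>\<eta>\<close> is \<open>1 / 2 + Re (\<eta> * z)\<close>.
  The maximum over \<open>\<eta>\<close> is attained twice iff \<open>z\<close> is a nonnegative multiple of a \<open>d\<close>-th root of unity, which
  describes the twisted join. Where it is attained once, the minimal geodesic can be extended.\<close>

section \<open>Distance and geodesics on the unit sphere\<close>

text \<open>For orthonormal p and v this is the unit speed great circle from p in direction v. Its
  derivative has the same form, with v and - p in place of p and v.\<close>

definition great_circle :: "'a::real_inner \<Rightarrow> 'a \<Rightarrow> real \<Rightarrow> 'a" where
  "great_circle p v t = cos t *\<^sub>R p + sin t *\<^sub>R v"

lemma great_circle_0 [simp]: "great_circle p v 0 = p"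
  by (simp add: great_circle_def)

lemma great_circle_derivative:
  "(great_circle p v has_vector_derivative great_circle v (- p) t) (at t within S)"
  unfolding great_circle_def[abs_def]
  by (auto intro!: derivative_eq_intros simp: has_real_derivative_iff_has_vector_derivative[symmetric])

lemma inner_great_circle: "x \<bullet> great_circle p v t = cos t * (x \<bullet> p) + sin t * (x \<bullet> v)"
  by (simp add: great_circle_def inner_add_right)

lemma norm_great_circle:
  assumes "norm p = 1" "norm v = 1" "p \<bullet> v = 0"
  shows "norm (great_circle p v t) = 1"
proof -
  have "great_circle p v t \<bullet> great_circle p v t = (cos t)\<^sup>2 + (sin t)\<^sup>2"
    using assms by (simp add: great_circle_def inner_add_left inner_add_right
        inner_commute[of v p] power2_eq_square norm_eq_1)
  then show ?thesis by (simp add: norm_eq_1)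
qed

text \<open>Gram-Schmidt: v is the normalized component of q orthogonal to p. For q = p or q = - p
  this component vanishes, and \<open>dim\<close> provides some unit vector orthogonal to p.\<close>

lemma great_circle_through:
  fixes p q :: "'a::euclidean_space"
  assumes dim: "2 \<le> DIM('a)" and p: "norm p = 1" and q: "norm q = 1"
  obtains v where "norm v = 1" "p \<bullet> v = 0" "great_circle p v (arccos (p \<bullet> q)) = q"
proof -
  have pq: "\<bar>p \<bullet> q\<bar> \<le> 1" using Cauchy_Schwarz_ineq2[of p q] p q by simp
  define s where "s = sin (arccos (p \<bullet> q))"
  define w where "w = q - (p \<bullet> q) *\<^sub>R p"
  have c: "cos (arccos (p \<bullet> q)) = p \<bullet> q" using pq by (simp add: cos_arccos_abs)
  have s0: "s \<ge> 0" unfolding s_def using pq by (intro sin_ge_zero) (auto intro: arccos_lbound arccos_ubound)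
  have s2: "s\<^sup>2 = 1 - (p \<bullet> q)\<^sup>2" unfolding s_def by (simp add: sin_squared_eq c)
  have "w \<bullet> w = 1 - (p \<bullet> q)\<^sup>2"
    using p q by (simp add: w_def inner_diff_left inner_diff_right norm_eq_1 inner_commute[of q p] power2_eq_square)
  then have nw: "norm w = s" using s0 s2
    by (metis norm_eq_sqrt_inner real_sqrt_unique)
  have pw: "p \<bullet> w = 0" using p by (simp add: w_def inner_diff_right norm_eq_1)
  show thesis
  proof (cases "s = 0")
    case True
    obtain y where y: "y \<noteq> 0" "orthogonal p y" using orthogonal_to_vector_exists[OF dim] by blast
    show thesis
    proof (rule that[of "sgn y"])
      show "great_circle p (sgn y) (arccos (p \<bullet> q)) = q"
        using True nw by (simp add: great_circle_def c s_def[symmetric] w_def)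
    qed (use y in \<open>auto simp: norm_sgn orthogonal_def sgn_div_norm\<close>)
  next
    case False
    show thesis
    proof (rule that[of "w /\<^sub>R s"])
      show "great_circle p (w /\<^sub>R s) (arccos (p \<bullet> q)) = q"
        using False by (simp add: great_circle_def c s_def[symmetric] w_def)
    qed (use False nw pw s0 in auto)
  qed
qed

text \<open>The function \<^term>\<open>arccos\<close> is not differentiable at \<open>1\<close> and \<open>- 1\<close>; after scaling its argument by \<open>r < 1\<close>
  it can be differentiated along the whole path, and \<open>r\<close> tends to \<open>1\<close> at the end.\<close>
lemma sphere_path_length_ge:
  fixes g :: "real \<Rightarrow> 'a::euclidean_space"
  assumes g: "valid_path g" "path_image g \<subseteq> sphere 0 1" and L: "has_length g 0 1 L"
  shows "arccos (pathstart g \<bullet> pathfinish g) \<le> L"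
proof -
  define p where "p = pathstart g"
  define h where "h t = p \<bullet> g t" for t
  define g' where "g' t = vector_derivative g (at t within {0..1})" for t
  have ng: "norm (g t) = 1" if "t \<in> {0..1}" for t
  proof -
    have "g t \<in> sphere 0 1" using g(2) that unfolding path_image_def by blast
    then show ?thesis by (simp only: mem_sphere_0)
  qed
  have np: "norm p = 1" using ng[of 0] by (simp add: p_def pathstart_def)
  have h1: "\<bar>h t\<bar> \<le> 1" if "t \<in> {0..1}" for t
    using Cauchy_Schwarz_ineq2[of p "g t"] np ng[OF that] by (simp add: h_def)
  have contg: "continuous_on {0..1} g"
    using g(1) valid_path_imp_path path_def by blast
  obtain S where S: "finite S" and gd: "\<And>t. t \<in> {0..1} - S \<Longrightarrow> g differentiable at t"
    using g(1) unfolding valid_path_def piecewise_C1_differentiable_on_def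
    by (meson C1_differentiable_on_eq)
  \<comment> \<open>The value 0 at the end points and on \<open>S\<close> is a dummy: the
    fundamental theorem of calculus exempts these finitely many points, and 0 is below any
    norm.\<close>
  define D where "D r t = (if t \<in> {0<..<1} - S then - (r * (p \<bullet> g' t)) / sqrt (1 - (r * h t)\<^sup>2) else 0)" for r t
  have key: "arccos (r * h 1) - arccos (r * h 0) \<le> L" if r: "0 < r" "r < 1" for r
  proof -
    have rh: "\<bar>r * h t\<bar> < 1" if "t \<in> {0..1}" for t
    proof -
      have "\<bar>r * h t\<bar> \<le> r" using h1[OF that] r by (simp add: abs_mult mult_left_le)
      then show ?thesis using r by simp
    qed
    have der: "(g has_vector_derivative g' t) (at t)" if "t \<in> {0<..<1} - S" for t
    proof -
      have "g' t = vector_derivative g (at t)"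
        using that gd unfolding g'_def
        by (intro vector_derivative_at_within_ivl[where a=0 and b=1]) (auto simp: vector_derivative_works[symmetric])
      then show ?thesis using gd[of t] that by (simp add: vector_derivative_works[symmetric])
    qed
    have "((\<lambda>t. arccos (r * h t)) has_vector_derivative D r t) (at t)" if t: "t \<in> {0<..<1} - S" for t
    proof -
      have "((\<lambda>t. p \<bullet> g t) has_vector_derivative p \<bullet> g' t) (at t)"
        by (rule bounded_linear.has_vector_derivative[OF bounded_linear_inner_right der[OF t]])
      then have hd: "(h has_real_derivative p \<bullet> g' t) (at t)"
        by (simp add: h_def[abs_def] has_real_derivative_iff_has_vector_derivative)
      have "((\<lambda>t. arccos (r * h t)) has_real_derivative inverse (- sqrt (1 - (r * h t)\<^sup>2)) * (r * (p \<bullet> g' t))) (at t)"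
        by (rule DERIV_chain2[where f = arccos, OF DERIV_arccos]) (use rh[of t] t in \<open>auto intro!: derivative_eq_intros hd\<close>)
      then show ?thesis
        using t by (simp add: D_def has_real_derivative_iff_has_vector_derivative[symmetric] divide_inverse mult.commute)
    qed
    moreover have "continuous_on {0..1} (\<lambda>t. arccos (r * h t))"
      unfolding h_def
      by (intro continuous_intros contg) (use rh in \<open>force simp: h_def abs_less_iff\<close>)+
    ultimately have I: "(D r has_integral arccos (r * h 1) - arccos (r * h 0)) {0..1}"
      by (intro fundamental_theorem_of_calculus_interior_strong[OF S]) auto
    have "D r t \<le> norm (g' t)" if "t \<in> {0..1}" for t
    proof (cases "t \<in> {0<..<1} - S")
      case t: True
      have "((\<lambda>t. g t \<bullet> g t) has_vector_derivative g t \<bullet> g' t + g' t \<bullet> g t) (at t)"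
        by (intro bounded_bilinear.has_vector_derivative[OF bounded_bilinear_inner] der t)
      moreover have "((\<lambda>t. g t \<bullet> g t) has_vector_derivative 0) (at t)"
        by (rule has_vector_derivative_transform_within_open[OF has_vector_derivative_const, of "{0<..<1}" _ 1])
           (use t ng in \<open>auto simp: norm_eq_1\<close>)
      ultimately have "g t \<bullet> g' t + g' t \<bullet> g t = 0" using vector_derivative_unique_at by blast
      then have gg': "g t \<bullet> g' t = 0" by (simp add: inner_commute)
      \<comment> \<open>Since \<open>g' t\<close> is orthogonal to \<open>g t\<close>, only the
        component of p orthogonal to \<open>g t\<close> contributes to
        \<open>p \<bullet> g' t\<close>; its norm is computed here.\<close>
      have "(p - h t *\<^sub>R g t) \<bullet> (p - h t *\<^sub>R g t) = 1 - (h t)\<^sup>2"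
        using np ng[OF that] by (simp add: inner_diff_left inner_diff_right norm_eq_1
            h_def inner_commute[of "g t" p] power2_eq_square)
      then have npg: "norm (p - h t *\<^sub>R g t) = sqrt (1 - (h t)\<^sup>2)"
        by (simp add: norm_eq_sqrt_inner)
      have "\<bar>p \<bullet> g' t\<bar> = \<bar>(p - h t *\<^sub>R g t) \<bullet> g' t\<bar>" by (simp add: inner_diff_left gg')
      also have "\<dots> \<le> sqrt (1 - (h t)\<^sup>2) * norm (g' t)"
        using Cauchy_Schwarz_ineq2 npg by metis
      finally have 1: "\<bar>p \<bullet> g' t\<bar> \<le> sqrt (1 - (h t)\<^sup>2) * norm (g' t)" .
      have "(r * h t)\<^sup>2 \<le> (h t)\<^sup>2"
        using r by (simp add: power_mult_distrib mult_left_le_one_le power_le_one)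
      then have 2: "sqrt (1 - (h t)\<^sup>2) \<le> sqrt (1 - (r * h t)\<^sup>2)" by simp
      have pos: "0 < sqrt (1 - (r * h t)\<^sup>2)" using rh[OF that] by (simp add: abs_square_less_1)
      have "- (r * (p \<bullet> g' t)) \<le> r * \<bar>p \<bullet> g' t\<bar>"
        using r mult_left_mono[of "- (p \<bullet> g' t)" "\<bar>p \<bullet> g' t\<bar>" r] by simp
      also have "\<dots> \<le> \<bar>p \<bullet> g' t\<bar>"
        using r by (simp add: mult_left_le_one_le)
      also have "\<dots> \<le> sqrt (1 - (r * h t)\<^sup>2) * norm (g' t)"
        using 1 2 by (meson dual_order.trans mult_right_mono norm_ge_zero)
      finally show ?thesis using pos t by (simp add: D_def divide_simps mult.commute)
    qed (auto simp: D_def)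
    with I L[unfolded has_length_def, folded g'_def] show ?thesis
      by (rule has_integral_le)
  qed
  define F where "F r = arccos (r * h 1) - arccos (r * h 0)" for r
  have "continuous_on {0..1} F" unfolding F_def
  proof (intro continuous_intros ballI)
    fix r :: real assume r: "r \<in> {0..1}"
    have "\<bar>r * h t\<bar> \<le> 1" if "t \<in> {0..1}" for t
      using h1[OF that] r by (simp add: abs_mult mult_le_one)
    from this[of 0] this[of 1] show "- 1 \<le> r * h 0 \<and> r * h 0 \<le> 1" "- 1 \<le> r * h 1 \<and> r * h 1 \<le> 1"
      by (auto simp: abs_le_iff)
  qed
  then have "(F \<longlongrightarrow> F 1) (at 1 within {0..1})" by (simp add: continuous_on_def)
  then have "(F \<longlongrightarrow> F 1) (at_left 1)" by (simp add: at_within_Icc_at_left)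
  moreover have "\<forall>\<^sub>F r in at_left 1. F r \<le> L"
    using eventually_at_left_real[of 0 1] by (rule eventually_mono) (auto simp: F_def key)
  ultimately have "F 1 \<le> L" by (rule tendsto_upperbound) auto
  \<comment> \<open>So the subtracted arccos in \<open>F 1\<close> is 0, and \<open>F 1\<close> is
    the angle between the end points.\<close>
  moreover have "h 0 = 1" using np by (simp add: h_def p_def pathstart_def norm_eq_1)
  ultimately show ?thesis by (simp add: F_def h_def p_def pathfinish_def)
qed

text \<open>The great circle arc, run at constant speed \<open>\<alpha>\<close> over the unit
  interval, attains the lower bound of \<open>sphere_path_length_ge\<close>, so the infimum is a
  minimum.\<close>

lemma riemannian_dist_sphere:
  fixes p q :: "'a::euclidean_space"
  assumes dim: "2 \<le> DIM('a)" and p: "norm p = 1" and q: "norm q = 1"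
  shows "riemannian_dist (sphere 0 1) p q = arccos (p \<bullet> q)"
proof -
  define \<alpha> where "\<alpha> = arccos (p \<bullet> q)"
  obtain v where v: "norm v = 1" "p \<bullet> v = 0" "great_circle p v \<alpha> = q"
    using great_circle_through[OF dim p q] unfolding \<alpha>_def by blast
  have "\<bar>p \<bullet> q\<bar> \<le> 1" using Cauchy_Schwarz_ineq2[of p q] p q by simp
  then have \<alpha>0: "0 \<le> \<alpha>" unfolding \<alpha>_def by (intro arccos_lbound) auto
  define c where "c t = great_circle p v (\<alpha> * t)" for t
  have d: "(c has_vector_derivative \<alpha> *\<^sub>R great_circle v (- p) (\<alpha> * t)) (at t within S)" for t S
  proof -
    have "((\<lambda>t. \<alpha> * t) has_vector_derivative \<alpha>) (at t within S)"
      by (auto intro!: derivative_eq_intros simp: has_real_derivative_iff_has_vector_derivative[symmetric])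
    from vector_diff_chain_within[OF this great_circle_derivative]
    show ?thesis by (simp add: c_def[abs_def] o_def)
  qed
  have vp: "v \<bullet> - p = 0" using v by (simp add: inner_commute)
  have "continuous_on {0..1} (\<lambda>t. \<alpha> *\<^sub>R great_circle v (- p) (\<alpha> * t))"
    unfolding great_circle_def by (intro continuous_intros)
  with d have "c C1_differentiable_on {0..1}"
    unfolding C1_differentiable_on_def
    by (intro exI[of _ "\<lambda>t. \<alpha> *\<^sub>R great_circle v (- p) (\<alpha> * t)"] conjI ballI)
  then have "valid_path c" unfolding valid_path_def by (rule C1_differentiable_imp_piecewise)
  moreover have "path_image c \<subseteq> sphere 0 1"
    using norm_great_circle[OF p v(1,2)] by (auto simp: path_image_def c_def)
  moreover have "pathstart c = p" "pathfinish c = q"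
    using v by (auto simp: pathstart_def pathfinish_def c_def)
  moreover have "has_length c 0 1 \<alpha>"
  proof -
    have "norm (vector_derivative c (at t within {0..1})) = \<alpha>" if "t \<in> {0..1}" for t
    proof -
      have "vector_derivative c (at t within {0..1}) = \<alpha> *\<^sub>R great_circle v (- p) (\<alpha> * t)"
        using vector_derivative_within_cbox[of 0 1 t c] d[of t "{0..1}"] that by simp
      then show ?thesis using norm_great_circle[of v "- p"] vp v p \<alpha>0 by simp
    qed
    moreover have "((\<lambda>t. \<alpha>) has_integral \<alpha>) {0..1::real}"
      using has_integral_const_real[of \<alpha> 0 1] by simp
    ultimately show ?thesis unfolding has_length_def by (subst has_integral_cong) auto
  qed
  ultimately have 1: "\<alpha> \<in> {L. \<exists>c. valid_path c \<and> path_image c \<subseteq> sphere 0 1 \<and> pathstart c = p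
      \<and> pathfinish c = q \<and> has_length c 0 1 L}" by blast
  have "\<alpha> \<le> L" if "valid_path c" "path_image c \<subseteq> sphere 0 1" "pathstart c = p" "pathfinish c = q"
    "has_length c 0 1 L" for c L
    using sphere_path_length_ge[OF that(1,2,5)] that(3,4) by (simp add: \<alpha>_def)
  then show ?thesis unfolding riemannian_dist_def \<alpha>_def[symmetric]
    by (intro cInf_eq_minimum[OF 1]) blast
qed


section \<open>Tangent spaces and geodesics of the sphere\<close>

lemma tangent_space_sphere:
  fixes p :: "'a::euclidean_space"
  assumes p: "norm p = 1"
  shows "tangent_space (sphere 0 1) p = {w. p \<bullet> w = 0}"
proof (intro set_eqI iffI CollectI)
  fix w assume "w \<in> tangent_space (sphere 0 1) p"
  then obtain c :: "real \<Rightarrow> 'a" where c: "c 0 = p" "\<forall>\<^sub>F t in nhds 0. c t \<in> sphere 0 1"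
    "(c has_vector_derivative w) (at 0)" unfolding tangent_space_def by blast
  obtain U where U: "open U" "0 \<in> U" "\<And>t. t \<in> U \<Longrightarrow> norm (c t) = 1"
    using c(2) by (auto simp: eventually_nhds)
  have "((\<lambda>t. c t \<bullet> c t) has_vector_derivative c 0 \<bullet> w + w \<bullet> c 0) (at 0)"
    by (intro bounded_bilinear.has_vector_derivative[OF bounded_bilinear_inner] c)
  moreover have "((\<lambda>t. c t \<bullet> c t) has_vector_derivative 0) (at 0)"
    by (rule has_vector_derivative_transform_within_open[OF has_vector_derivative_const, of U _ 1])
       (use U in \<open>auto simp: norm_eq_1\<close>)
  ultimately have "c 0 \<bullet> w + w \<bullet> c 0 = 0" using vector_derivative_unique_at by blast
  then show "p \<bullet> w = 0" by (simp add: c(1) inner_commute)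
next
  fix w assume "w \<in> {w. p \<bullet> w = 0}"
  then have w: "p \<bullet> w = 0" by simp
  \<comment> \<open>The great circle run at speed \<open>norm w\<close>; for w = 0 it is the
    constant curve.\<close>
  define c where "c t = cos (norm w * t) *\<^sub>R p + sin (norm w * t) *\<^sub>R sgn w" for t
  have "norm (c t) = 1" for t
  proof (cases "w = 0")
    case False
    then show ?thesis
      using norm_great_circle[of p "sgn w" "norm w * t"] p w
      by (simp add: c_def great_circle_def norm_sgn sgn_div_norm)
  qed (simp add: c_def p)
  moreover have "(c has_vector_derivative w) (at 0)"
  proof -
    have "(c has_vector_derivative norm w *\<^sub>R sgn w) (at 0)" unfolding c_def[abs_def]
      by (auto intro!: derivative_eq_intros simp: has_real_derivative_iff_has_vector_derivative[symmetric])
    then show ?thesis by (cases "w = 0") (simp_all add: sgn_div_norm)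
  qed
  moreover have "c 0 = p" by (simp add: c_def)
  ultimately show "w \<in> tangent_space (sphere 0 1) p"
    unfolding tangent_space_def by auto
qed

text \<open>The second derivative of a great circle is minus the curve itself, which is normal to
  the sphere.\<close>

lemma geodesic_great_circle:
  fixes p v :: "'a::euclidean_space"
  assumes "norm p = 1" "norm v = 1" "p \<bullet> v = 0" "0 \<le> l"
  shows "geodesic (sphere 0 1) (great_circle p v) l"
proof -
  have n: "norm (great_circle p v t) = 1" for t
    using assms by (intro norm_great_circle)
  have n': "norm (great_circle v (- p) t) = 1" for t
    using assms by (intro norm_great_circle) (auto simp: inner_commute)
  have "great_circle (- p) (- v) t = - great_circle p v t" for t
    by (simp add: great_circle_def)
  then have "\<forall>w\<in>tangent_space (sphere 0 1) (great_circle p v t). great_circle (- p) (- v) t \<bullet> w = 0" for t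
    by (simp add: tangent_space_sphere[OF n])
  then show ?thesis
    unfolding geodesic_def using assms(4) n n'
    by (intro conjI exI[of _ "great_circle v (- p)"] exI[of _ "great_circle (- p) (- v)"] ballI)
       (auto intro: great_circle_derivative)
qed

text \<open>On the sphere the geodesic equation is \<open>c'' = - c\<close>, so \<open>cos t c - sin t c'\<close> and
  \<open>sin t c + cos t c'\<close> are constant.\<close>
lemma geodesic_sphere_great_circle:
  fixes c :: "real \<Rightarrow> 'a::euclidean_space"
  assumes dim: "2 \<le> DIM('a)" and c: "geodesic (sphere 0 1) c l"
  obtains v where "norm v = 1" "c 0 \<bullet> v = 0" "\<And>t. t \<in> {0..l} \<Longrightarrow> c t = great_circle (c 0) v t"
proof -
  have l: "0 \<le> l" using c by (simp add: geodesic_def)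
  obtain v a where va: "\<And>t. t \<in> {0..l} \<Longrightarrow> c t \<in> sphere 0 1
        \<and> (c has_vector_derivative v t) (at t within {0..l})
        \<and> (v has_vector_derivative a t) (at t within {0..l})
        \<and> norm (v t) = 1
        \<and> (\<forall>w\<in>tangent_space (sphere 0 1) (c t). a t \<bullet> w = 0)"
    using c unfolding geodesic_def by blast
  show thesis
  proof (cases "l = 0")
    \<comment> \<open>A geodesic on a one-point interval is just a point, so any unit vector
      orthogonal to it serves as direction.\<close>
    case True
    obtain y where y: "y \<noteq> 0" "orthogonal (c 0) y" using orthogonal_to_vector_exists[OF dim] by blast
    show thesis
      by (rule that[of "sgn y"]) (use y True in \<open>auto simp: norm_sgn orthogonal_def sgn_div_norm\<close>)
  next
    case False
    with l have l: "0 < l" by simp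
    note cd = va[THEN conjunct2, THEN conjunct1]
    note vd = va[THEN conjunct2, THEN conjunct2, THEN conjunct1]
    have nc: "norm (c t) = 1" and nv: "norm (v t) = 1" if "t \<in> {0..l}" for t using va[OF that] by auto
    have uniq: "x = y" if "(f has_vector_derivative x) (at t within {0..l})"
      "(f has_vector_derivative y) (at t within {0..l})" "t \<in> {0..l}" for f :: "real \<Rightarrow> real" and x y t
      using vector_derivative_unique_within_closed_interval[OF l, of t f x y] that by simp
    have cv: "c t \<bullet> v t = 0" if t: "t \<in> {0..l}" for t
    proof -
      have "((\<lambda>t. c t \<bullet> c t) has_vector_derivative c t \<bullet> v t + v t \<bullet> c t) (at t within {0..l})"
        by (intro bounded_bilinear.has_vector_derivative[OF bounded_bilinear_inner] cd t)
      moreover have "((\<lambda>t. c t \<bullet> c t) has_vector_derivative 0) (at t within {0..l})"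
        by (rule has_vector_derivative_transform[OF t _ has_vector_derivative_const, of _ 1])
           (use nc in \<open>auto simp: norm_eq_1\<close>)
      ultimately have "c t \<bullet> v t + v t \<bullet> c t = 0" using t by (rule uniq)
      then show ?thesis by (simp add: inner_commute)
    qed
    have ac: "a t = - c t" if t: "t \<in> {0..l}" for t
    proof -
      have "((\<lambda>t. c t \<bullet> v t) has_vector_derivative c t \<bullet> a t + v t \<bullet> v t) (at t within {0..l})"
        by (intro bounded_bilinear.has_vector_derivative[OF bounded_bilinear_inner] cd vd t)
      moreover have "((\<lambda>t. c t \<bullet> v t) has_vector_derivative 0) (at t within {0..l})"
        by (rule has_vector_derivative_transform[OF t _ has_vector_derivative_const, of _ 0])
           (use cv in auto)
      ultimately have "c t \<bullet> a t + v t \<bullet> v t = 0" using t by (rule uniq)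
      then have 1: "c t \<bullet> a t = - 1" using nv[OF t] by (simp add: norm_eq_1)
      \<comment> \<open>\<open>w\<close> is tangent and the acceleration is normal, so
        \<open>w\<close> is orthogonal to both of its summands and vanishes.\<close>
      define w where "w = a t + c t"
      have "c t \<bullet> w = 0" using 1 nc[OF t] by (simp add: w_def inner_add_right norm_eq_1)
      moreover from this have "a t \<bullet> w = 0" using va[OF t] tangent_space_sphere[OF nc[OF t]] by simp
      ultimately have "w \<bullet> w = 0" by (simp add: w_def inner_add_left)
      then show ?thesis by (simp add: w_def add_eq_0_iff2)
    qed
    define X where "X t = cos t *\<^sub>R c t - sin t *\<^sub>R v t" for t
    define Y where "Y t = sin t *\<^sub>R c t + cos t *\<^sub>R v t" for t
    have "(X has_vector_derivative 0) (at t within {0..l})" if t: "t \<in> {0..l}" for t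
      unfolding X_def[abs_def] using cd[OF t] vd[OF t] ac[OF t]
      by (auto intro!: derivative_eq_intros simp: has_real_derivative_iff_has_vector_derivative[symmetric])
    then obtain A where A: "\<And>t. t \<in> {0..l} \<Longrightarrow> X t = A"
      using has_vector_derivative_zero_constant[of "{0..l}" X] by (metis convex_closed_interval)
    have "(Y has_vector_derivative 0) (at t within {0..l})" if t: "t \<in> {0..l}" for t
      unfolding Y_def[abs_def] using cd[OF t] vd[OF t] ac[OF t]
      by (auto intro!: derivative_eq_intros simp: has_real_derivative_iff_has_vector_derivative[symmetric])
    then obtain B where B: "\<And>t. t \<in> {0..l} \<Longrightarrow> Y t = B"
      using has_vector_derivative_zero_constant[of "{0..l}" Y] by (metis convex_closed_interval)
    have AB: "A = c 0" "B = v 0" using A[of 0] B[of 0] l by (auto simp: X_def Y_def)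
    have "c t = cos t *\<^sub>R X t + sin t *\<^sub>R Y t" for t
    proof -
      have "cos t *\<^sub>R X t + sin t *\<^sub>R Y t = (cos t * cos t) *\<^sub>R c t + (sin t * sin t) *\<^sub>R c t"
        unfolding X_def Y_def by (simp add: algebra_simps)
      also have "\<dots> = c t" unfolding scaleR_add_left[symmetric] by simp
      finally show ?thesis by simp
    qed
    then have gc: "c t = great_circle (c 0) (v 0) t" if "t \<in> {0..l}" for t
      using A[OF that] B[OF that] AB by (metis great_circle_def)
    have "0 \<in> {0..l}" using l by simp
    then show thesis using that[OF nv cv gc] by blast
  qed
qed

section \<open>Lengths of geodesics, minimality and cut points\<close>

lemma has_length_geodesic_iff:
  fixes c :: "real \<Rightarrow> 'a::euclidean_space"
  assumes "geodesic M c l"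
  shows "has_length c 0 l L \<longleftrightarrow> L = l"
proof -
  have l: "0 \<le> l" using assms by (simp add: geodesic_def)
  obtain v a where va: "\<And>t. t \<in> {0..l} \<Longrightarrow> c t \<in> M
        \<and> (c has_vector_derivative v t) (at t within {0..l})
        \<and> (v has_vector_derivative a t) (at t within {0..l})
        \<and> norm (v t) = 1
        \<and> (\<forall>w\<in>tangent_space M (c t). a t \<bullet> w = 0)"
    using assms unfolding geodesic_def by blast
  have I: "((\<lambda>t. norm (vector_derivative c (at t within {0..l}))) has_integral l) {0..l}"
  \<comment> \<open>On a one-point interval the value of \<open>vector_derivative\<close> is
    arbitrary, but the integral is 0 in any case.\<close>
  proof (cases "l = 0")
    case False
    have "1 = norm (vector_derivative c (at t within {0..l}))" if "t \<in> {0..l}" for t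
      using vector_derivative_within_cbox[of 0 l t c "v t"] va[OF that] that l False by simp
    moreover have "((\<lambda>t. 1) has_integral l) {0..l}"
      using has_integral_const_real[of "1::real" 0 l] l by simp
    ultimately show ?thesis by (rule has_integral_eq)
  qed (simp add: has_integral_refl)
  show ?thesis unfolding has_length_def using I has_integral_unique[OF I] by blast
qed

text \<open>A geodesic of length l from \<open>c 0\<close> to q has
  \<open>c 0 \<bullet> q = cos l\<close>, and the distance from N to q is the infimum of
  \<open>arccos (x \<bullet> q)\<close>. As arccos is decreasing, minimality becomes a comparison of
  inner products; \<open>l \<le> pi\<close> excludes other lengths with the same cosine.\<close>

lemma dist_minimal_geodesic_sphere_iff:
  fixes N :: "'a::euclidean_space set"
  assumes dim: "2 \<le> DIM('a)" and N: "N \<subseteq> sphere 0 1"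
  shows "dist_minimal_geodesic (sphere 0 1) N q c l \<longleftrightarrow>
    geodesic (sphere 0 1) c l \<and> c 0 \<in> N \<and> c l = q \<and> l \<le> pi \<and> (\<forall>x\<in>N. x \<bullet> q \<le> cos l)"
proof -
  have "riemannian_setdist (sphere 0 1) N q = l \<longleftrightarrow> l \<le> pi \<and> (\<forall>x\<in>N. x \<bullet> q \<le> cos l)"
    if c: "geodesic (sphere 0 1) c l" "c 0 \<in> N" "c l = q"
  proof -
    have l: "0 \<le> l" using c(1) by (simp add: geodesic_def)
    have ll: "l \<in> {0..l}" using l by simp
    have "c l \<in> sphere 0 1" using c(1) ll unfolding geodesic_def by blast
    then have q: "norm q = 1" using c(3) by (simp only: mem_sphere_0)
    have c0: "norm (c 0) = 1" using c(2) N by (auto simp only: mem_sphere_0 dest: subsetD)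
    obtain v where "norm v = 1" "c 0 \<bullet> v = 0" "c l = great_circle (c 0) v l"
      using geodesic_sphere_great_circle[OF dim c(1)] ll by metis
    then have xq: "c 0 \<bullet> q = cos l" using c0 by (simp add: inner_great_circle norm_eq_1 c(3)[symmetric])
    have n: "norm x = 1" if "x \<in> N" for x using N that by auto
    have bd: "\<bar>x \<bullet> q\<bar> \<le> 1" if "x \<in> N" for x
      using Cauchy_Schwarz_ineq2[of x q] n[OF that] q by simp
    have sd: "riemannian_setdist (sphere 0 1) N q = (INF x\<in>N. arccos (x \<bullet> q))"
      unfolding riemannian_setdist_def
      by (intro INF_cong refl riemannian_dist_sphere[OF dim] n q)
    show ?thesis
    proof
      assume e: "riemannian_setdist (sphere 0 1) N q = l"
      have le: "l \<le> arccos (x \<bullet> q)" if x: "x \<in> N" for x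
        unfolding e[symmetric] sd
      proof (rule cINF_lower[OF _ x])
        show "bdd_below ((\<lambda>x. arccos (x \<bullet> q)) ` N)"
          using bd by (intro bdd_belowI2[of _ 0] arccos_lbound) (auto simp: abs_le_iff)
      qed
      have ub: "arccos (x \<bullet> q) \<le> pi" if "x \<in> N" for x
        using bd[OF that] by (intro arccos_ubound) auto
      have "x \<bullet> q \<le> cos l" if x: "x \<in> N" for x
        using cos_monotone_0_pi_le[OF l le[OF x] ub[OF x]] bd[OF x] by (simp add: cos_arccos_abs)
      then show "l \<le> pi \<and> (\<forall>x\<in>N. x \<bullet> q \<le> cos l)" using le[OF c(2)] ub[OF c(2)] by simp
    next
      assume a: "l \<le> pi \<and> (\<forall>x\<in>N. x \<bullet> q \<le> cos l)"
      then have al: "arccos (cos l) = l" using l by (simp add: arccos_cos)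
      show "riemannian_setdist (sphere 0 1) N q = l" unfolding sd
      proof (rule cInf_eq_minimum)
        show "l \<in> (\<lambda>x. arccos (x \<bullet> q)) ` N" by (rule image_eqI[OF _ c(2)]) (simp add: xq al)
        fix y assume "y \<in> (\<lambda>x. arccos (x \<bullet> q)) ` N"
        then obtain x where x: "x \<in> N" "y = arccos (x \<bullet> q)" by blast
        show "l \<le> y" using arccos_le_mono[of "cos l" "x \<bullet> q"] bd[OF x(1)] a x al by simp
      qed
    qed
  qed
  then show ?thesis unfolding dist_minimal_geodesic_def
    using has_length_geodesic_iff[of "sphere 0 1" c l] by blast
qed

lemma inner_unit_vectors_less_1:
  fixes x y :: "'a::real_inner"
  assumes "norm x = 1" "norm y = 1" "x \<noteq> y"
  shows "x \<bullet> y < 1"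
proof -
  have "0 < (x - y) \<bullet> (x - y)" using assms by simp
  then show ?thesis using assms by (simp add: inner_diff_left inner_diff_right norm_eq_1 inner_commute[of y x])
qed

text \<open>If the arc from x stayed minimal beyond q, the path from x' to q and on along that arc
  would be equally short, although it is not smooth at q. The proof replaces this argument by a
  direct comparison of inner products.\<close>

lemma two_nearest_points_imp_cut:
  fixes N :: "'a::euclidean_space set"
  assumes dim: "2 \<le> DIM('a)" and N: "N \<subseteq> sphere 0 1" and q: "q \<in> sphere 0 1"
    and x: "x \<in> N" "x' \<in> N" "x \<noteq> x'" "x' \<bullet> q = x \<bullet> q"
    and max: "\<And>y. y \<in> N \<Longrightarrow> y \<bullet> q \<le> x \<bullet> q"
  shows "q \<in> cut_locus (sphere 0 1) N"
proof -
  define l where "l = arccos (x \<bullet> q)"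
  have n: "norm x = 1" "norm x' = 1" "norm q = 1" using N q x by auto
  have bd: "\<bar>x \<bullet> q\<bar> \<le> 1" using Cauchy_Schwarz_ineq2[of x q] n by simp
  \<comment> \<open>Only q itself has inner product 1 with q among unit vectors, and x and x' cannot
    both be q.\<close>
  have "x \<bullet> q \<noteq> 1"
    using inner_unit_vectors_less_1[OF n(1,3)] inner_unit_vectors_less_1[OF n(2,3)] x(3,4) by force
  then have "0 < l" using bd arccos_less_arccos[of "x \<bullet> q" 1] by (simp add: l_def abs_le_iff)
  moreover have "l \<le> pi" using bd by (simp add: l_def arccos_ubound abs_le_iff)
  moreover have "cos l = x \<bullet> q" using bd by (simp add: l_def cos_arccos_abs)
  ultimately have l: "0 < l" "l \<le> pi" "cos l = x \<bullet> q" by auto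
  obtain v where v: "norm v = 1" "x \<bullet> v = 0" "great_circle x v l = q"
    using great_circle_through[OF dim n(1,3)] unfolding l_def by blast
  have xx': "x \<bullet> x' < 1"
    using inner_unit_vectors_less_1 n x(3) by blast
  have "dist_minimal_geodesic (sphere 0 1) N q (great_circle x v) l"
    using geodesic_great_circle[OF n(1) v(1,2)] l v x max
    by (auto simp: dist_minimal_geodesic_sphere_iff[OF dim N])
  moreover have False
    if lm: "l < m" and e: "geodesic (sphere 0 1) e m" "\<forall>t\<in>{0..l}. e t = great_circle x v t"
    and min: "dist_minimal_geodesic (sphere 0 1) N (e m) e m" for e m
  proof -
    have e0: "e 0 = x" and el: "e l = q" using e l v by auto
    obtain u where u: "norm u = 1" "x \<bullet> u = 0" "\<And>t. t \<in> {0..m} \<Longrightarrow> e t = great_circle x u t"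
      using geodesic_sphere_great_circle[OF dim e(1)] unfolding e0 by blast
    have m: "m \<le> pi" "x' \<bullet> e m \<le> cos m"
      using min x by (auto simp: dist_minimal_geodesic_sphere_iff[OF dim N])
    \<comment> \<open>Along e the inner product with x' is \<open>A * cos t + B * sin t\<close>, and
      with x it is \<open>cos t\<close>. They agree at l, and at m the former is no larger by
      minimality. Eliminating B leaves \<open>sin (m - l) \<le> 0\<close>.\<close>
    define A B where "A = x \<bullet> x'" and "B = x' \<bullet> u"
    have "A * cos m + B * sin m \<le> cos m"
      using m u(3)[of m] lm l by (simp add: inner_great_circle A_def B_def inner_commute mult.commute)
    moreover have "A * cos l + B * sin l = cos l"
      using l(3) x(4) u(3)[of l] lm l(1) el by (simp add: inner_great_circle A_def B_def inner_commute mult.commute)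
    moreover have sl: "0 < sin l" "0 \<le> sin m" using l lm m by (auto intro!: sin_gt_zero sin_ge_zero)
    ultimately have "(1 - A) * (cos l * sin m) \<le> (1 - A) * (cos m * sin l)"
    proof -
      assume 1: "A * cos m + B * sin m \<le> cos m" and 2: "A * cos l + B * sin l = cos l"
      have "B * sin l = (1 - A) * cos l" using 2 by (simp add: algebra_simps)
      then have "(1 - A) * (cos l * sin m) = (B * sin l) * sin m" by simp
      also have "\<dots> = sin l * (B * sin m)" by simp
      also have "\<dots> \<le> sin l * ((1 - A) * cos m)" using 1 sl by (intro mult_left_mono) (auto simp: algebra_simps)
      finally show ?thesis by (simp add: mult_ac)
    qed
    then have "sin (m - l) \<le> 0" using xx' by (simp add: A_def sin_diff mult_ac)
    moreover have "0 < sin (m - l)" using lm m l by (intro sin_gt_zero) auto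
    ultimately show False by simp
  qed
  ultimately show ?thesis unfolding cut_locus_def using q by blast
qed

section \<open>Distance to the Hopf circles of the link\<close>

text \<open>As w runs over the unit circle, the largest value of \<open>scal w x \<bullet> q\<close>
  is \<open>cmod (herm x q)\<close>, so this modulus gives the distance from q to the Hopf circle
  through x.\<close>

definition herm :: "complex \<times> complex \<Rightarrow> complex \<times> complex \<Rightarrow> complex" where
  "herm x y = fst x * cnj (fst y) + snd x * cnj (snd y)"

lemma inner_eq_Re_herm: "x \<bullet> y = Re (herm x y)"
  by (simp add: inner_prod_def inner_complex_def herm_def)

lemma herm_scal: "herm (scal w x) y = w * herm x y"
  by (simp add: herm_def scal_def algebra_simps)

lemma mem_S3_iff: "x \<in> S3 \<longleftrightarrow> (cmod (fst x))\<^sup>2 + (cmod (snd x))\<^sup>2 = 1"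
  by (simp add: S3_def norm_prod_def)

lemma herm_self: "x \<in> S3 \<Longrightarrow> herm x x = 1"
  unfolding herm_def complex_norm_square[symmetric] of_real_add[symmetric] mem_S3_iff by simp

text \<open>The second coordinate over the first, for a point whose coordinates have modulus \<open>1 / sqrt 2\<close>.\<close>
definition ratio :: "complex \<times> complex \<Rightarrow> complex" where
  "ratio x = 2 * snd x * cnj (fst x)"

text \<open>The last term is the cross term of the expanded square; it sees x only through
  \<open>ratio x\<close>, which is constant on Hopf circles.\<close>

lemma cmod_herm_squared:
  "(cmod (herm x q))\<^sup>2 = (cmod (fst x))\<^sup>2 * (cmod (fst q))\<^sup>2 + (cmod (snd x))\<^sup>2 * (cmod (snd q))\<^sup>2
    + Re (ratio x * (fst q * cnj (snd q)))"
  unfolding herm_def ratio_def cmod_power2 by (simp add: power2_eq_square algebra_simps)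

text \<open>Taking moduli in the equation of the link shows that both coordinates have the same
  modulus. Hence \<open>2 * (fst x * cnj (fst x)) = 1\<close>, and by the equation
  \<open>ratio x ^ d\<close> is minus the d-th power of this number.\<close>

lemma fermat_link_coords:
  assumes d: "0 < d" and x: "x \<in> fermat_link d"
  shows "(cmod (fst x))\<^sup>2 = 1 / 2" "(cmod (snd x))\<^sup>2 = 1 / 2" "ratio x ^ d = - 1"
proof -
  have x1: "x \<in> S3" and x2: "fst x ^ d = - (snd x ^ d)"
    using x by (auto simp: fermat_link_def eq_neg_iff_add_eq_0)
  have "cmod (fst x) ^ d = cmod (snd x) ^ d"
    using arg_cong[OF x2, of cmod] by (simp add: norm_power)
  then have "cmod (fst x) = cmod (snd x)" using d by (metis norm_ge_zero power_eq_imp_eq_base)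
  then show c: "(cmod (fst x))\<^sup>2 = 1 / 2" "(cmod (snd x))\<^sup>2 = 1 / 2"
    using x1 by (auto simp: mem_S3_iff)
  have "ratio x ^ d = 2 ^ d * snd x ^ d * cnj (fst x) ^ d"
    by (simp add: ratio_def power_mult_distrib)
  also have "\<dots> = - ((2 * (fst x * cnj (fst x))) ^ d)"
    using x2 by (simp add: power_mult_distrib)
  also have "fst x * cnj (fst x) = 1 / 2"
    unfolding complex_norm_square[symmetric] c by simp
  finally show "ratio x ^ d = - 1" by simp
qed

text \<open>Equal moduli turn the first two terms of \<open>cmod_herm_squared\<close> into 1/2.
  Circles of the link are thus compared by a real-linear function of their ratio.\<close>

lemma cmod_herm_fermat_link:
  assumes "0 < d" "x \<in> fermat_link d" "q \<in> S3"
  shows "(cmod (herm x q))\<^sup>2 = 1 / 2 + Re (ratio x * (fst q * cnj (snd q)))"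
  using assms(3) by (simp add: cmod_herm_squared fermat_link_coords[OF assms(1,2)] mem_S3_iff add_divide_distrib[symmetric])

lemma scal_fermat_link:
  assumes "x \<in> fermat_link d" "cmod w = 1"
  shows "scal w x \<in> fermat_link d"
  using assms by (cases x) (auto simp: fermat_link_def mem_S3_iff scal_def norm_mult
      power_mult_distrib distrib_left[symmetric])

lemma ratio_scal: "cmod w = 1 \<Longrightarrow> ratio (scal w x) = ratio x"
proof -
  assume "cmod w = 1"
  then have "w * cnj w = 1" by (simp add: complex_norm_square[symmetric])
  moreover have "ratio (scal w x) = (w * cnj w) * ratio x" by (simp add: ratio_def scal_def)
  ultimately show ?thesis by simp
qed

text \<open>This moves a point along its Hopf circle until its Hermitian product with q is real and
  nonnegative, that is, to a point of that circle nearest to q.\<close>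

lemma rotate_to_nonneg_real:
  obtains w where "cmod w = 1" "w * h = of_real (cmod h)"
proof (cases "h = 0")
  case True
  then show thesis by (intro that[of 1]) auto
next
  case False
  show thesis
  proof (rule that[of "cnj (sgn h)"])
    show "cnj (sgn h) * h = of_real (cmod h)"
      using complex_norm_square[of h] False
      by (simp add: sgn_eq divide_simps mult.commute power2_eq_square)
  qed (use False in \<open>simp add: norm_sgn\<close>)
qed

lemma cmod_eq_1_of_power:
  assumes "0 < d" "\<eta> ^ d = - 1 \<or> \<eta> ^ d = (1::complex)"
  shows "cmod \<eta> = 1"
proof -
  have "cmod \<eta> ^ d = 1" using assms(2) by (auto simp flip: norm_power)
  then show ?thesis using assms(1) by (metis norm_ge_zero power_eq_1_iff not_gr_zero real_norm_def abs_of_nonneg)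
qed

text \<open>\<open>b\<close> is one point on the circle of \<eta>, and rotating it yields a point of
  that circle nearest to q.\<close>

lemma ex_fermat_link_ratio:
  assumes d: "0 < d" and \<eta>: "\<eta> ^ d = - 1"
  obtains x where "x \<in> fermat_link d" "ratio x = \<eta>" "x \<bullet> q = cmod (herm x q)"
proof -
  define b :: "complex \<times> complex" where "b = (of_real (sqrt (1 / 2)), of_real (sqrt (1 / 2)) * \<eta>)"
  have "cmod \<eta> = 1" using d \<eta> cmod_eq_1_of_power by blast
  then have "b \<in> fermat_link d"
    using \<eta> by (simp add: b_def fermat_link_def mem_S3_iff norm_mult power_mult_distrib)
  moreover have "ratio b = \<eta>"
    by (simp add: b_def ratio_def flip: of_real_mult)
  moreover obtain w where w: "cmod w = 1" "w * herm b q = of_real (cmod (herm b q))"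
    by (rule rotate_to_nonneg_real)
  ultimately show thesis
    by (intro that[of "scal w b"])
       (auto simp: scal_fermat_link ratio_scal inner_eq_Re_herm herm_scal)
qed

text \<open>Optimality along the Hopf circle of x alone suffices: some rotation of x has inner
  product \<open>cmod (herm x q)\<close> with q, so the real part of \<open>herm x q\<close> is
  already its modulus.\<close>

lemma herm_nearest:
  assumes x: "x \<in> fermat_link d" and max: "\<And>y. y \<in> fermat_link d \<Longrightarrow> y \<bullet> q \<le> x \<bullet> q"
  shows "herm x q = of_real (x \<bullet> q)" "0 \<le> x \<bullet> q"
proof -
  obtain w where w: "cmod w = 1" "w * herm x q = of_real (cmod (herm x q))"
    by (rule rotate_to_nonneg_real)
  have "scal w x \<bullet> q \<le> x \<bullet> q" using x w by (intro max scal_fermat_link)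
  then have le: "cmod (herm x q) \<le> Re (herm x q)" using w by (simp add: inner_eq_Re_herm herm_scal)
  then have "cmod (herm x q) = Re (herm x q)" using complex_Re_le_cmod[of "herm x q"] by simp
  then have "Im (herm x q) = 0" using cmod_power2[of "herm x q"] by simp
  then show "herm x q = of_real (x \<bullet> q)" by (simp add: inner_eq_Re_herm complex_eq_iff)
  show "0 \<le> x \<bullet> q" using le by (simp add: inner_eq_Re_herm order_trans[OF norm_ge_zero])
qed

text \<open>Compare x with a point nearest to q on the circle of \<eta>.\<close>

lemma ratio_nearest:
  assumes d: "0 < d" and x: "x \<in> fermat_link d" and q: "q \<in> S3"
    and max: "\<And>y. y \<in> fermat_link d \<Longrightarrow> y \<bullet> q \<le> x \<bullet> q" and \<eta>: "\<eta> ^ d = - 1"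
  shows "Re (\<eta> * (fst q * cnj (snd q))) \<le> Re (ratio x * (fst q * cnj (snd q)))"
proof -
  obtain y where y: "y \<in> fermat_link d" "ratio y = \<eta>" "y \<bullet> q = cmod (herm y q)"
    using ex_fermat_link_ratio[OF d \<eta>] by blast
  have "cmod (herm y q) \<le> cmod (herm x q)"
    using max[OF y(1)] y(3) complex_Re_le_cmod[of "herm x q"] by (simp add: inner_eq_Re_herm[of x])
  then have "(cmod (herm y q))\<^sup>2 \<le> (cmod (herm x q))\<^sup>2" by simp
  then show ?thesis using y(1,2) x d q by (simp add: cmod_herm_fermat_link)
qed

section \<open>Roots of -1 that maximize a real part\<close>

lemma Re_root_minus_one_le:
  assumes d: "0 < d" and w: "\<omega> ^ d = - 1"
  shows "Re \<omega> \<le> cos (pi / d)"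
proof -
  have n: "cmod \<omega> = 1" using d w cmod_eq_1_of_power by blast
  define a where "a = Arg \<omega>"
  have a: "\<bar>a\<bar> \<le> pi" using Arg_bounded[of \<omega>] by (simp add: a_def abs_le_iff)
  have om: "\<omega> = cis a" using n cis_Arg[of \<omega>] by (cases "\<omega> = 0") (auto simp: a_def sgn_eq)
  have "cis (d * a) = - 1" using w by (simp add: om Complex.DeMoivre)
  then have c: "cos (d * \<bar>a\<bar>) = - 1"
    by (metis abs_of_nat abs_mult cis.sel(1) cos_abs_real one_complex.sel(1) uminus_complex.sel(1))
  \<comment> \<open>Otherwise \<open>d * \<bar>a\<bar>\<close> would be at least 0 and below pi,
    where the cosine stays above -1.\<close>
  have "\<not> \<bar>a\<bar> < pi / d"
  proof
    assume "\<bar>a\<bar> < pi / d"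
    then have "d * \<bar>a\<bar> < pi" using d by (simp add: field_simps)
    then have "cos pi < cos (d * \<bar>a\<bar>)" by (intro cos_monotone_0_pi) auto
    then show False using c by simp
  qed
  then have "cos \<bar>a\<bar> \<le> cos (pi / d)" using a by (intro cos_monotone_0_pi_le) auto
  then show ?thesis by (simp add: om)
qed

text \<open>Multiplication by \<zeta> permutes the roots of -1, and those with the largest real part
  are \<open>cis (pi / d)\<close> and its conjugate. They differ because \<open>2 \<le> d\<close>
  puts \<open>pi / d\<close> strictly below pi.\<close>

lemma two_maximal_roots:
  fixes d :: nat
  assumes d: "2 \<le> d" and \<rho>: "0 \<le> \<rho>" and \<zeta>: "\<zeta> ^ d = 1"
  obtains \<eta> \<eta>' where "\<eta> ^ d = - 1" "\<eta>' ^ d = - 1" "\<eta> \<noteq> \<eta>'"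
    "Re (\<eta>' * (of_real \<rho> * \<zeta>)) = Re (\<eta> * (of_real \<rho> * \<zeta>))"
    "\<forall>\<mu>. \<mu> ^ d = - 1 \<longrightarrow> Re (\<mu> * (of_real \<rho> * \<zeta>)) \<le> Re (\<eta> * (of_real \<rho> * \<zeta>))"
proof -
  have d0: "0 < d" using d by simp
  have "cmod \<zeta> = 1" using d0 \<zeta> cmod_eq_1_of_power by blast
  then have zz: "cnj \<zeta> * \<zeta> = 1" using complex_norm_square[of \<zeta>] by (simp add: mult.commute)
  then have z0: "\<zeta> \<noteq> 0" by auto
  have R: "Re (\<mu> * (of_real \<rho> * \<zeta>)) = \<rho> * Re (\<mu> * \<zeta>)" for \<mu>
    by (simp add: algebra_simps)
  have C: "Re (cnj \<zeta> * cis t * \<zeta>) = cos t" for t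
  proof -
    have "cnj \<zeta> * cis t * \<zeta> = cnj \<zeta> * \<zeta> * cis t" by (simp only: mult_ac)
    then show ?thesis by (simp only: zz mult_1_left cis.sel)
  qed
  have P: "(cnj \<zeta> * cis t) ^ d = cis (d * t)" for t :: real
    using \<zeta> by (simp add: power_mult_distrib Complex.DeMoivre flip: complex_cnj_power)
  show thesis
  proof (rule that[of "cnj \<zeta> * cis (pi / d)" "cnj \<zeta> * cis (- (pi / d))"])
    show "(cnj \<zeta> * cis (pi / d)) ^ d = - 1" "(cnj \<zeta> * cis (- (pi / d))) ^ d = - 1"
      using P[of "pi / d"] P[of "- (pi / d)"] d0 cis_cnj[of pi] by simp_all
    have "0 < sin (pi / d)" using d by (intro sin_gt_zero) (auto simp: field_simps)
    then show "cnj \<zeta> * cis (pi / d) \<noteq> cnj \<zeta> * cis (- (pi / d))"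
      using z0 by (auto simp: complex_eq_iff)
    show "Re (cnj \<zeta> * cis (- (pi / d)) * (of_real \<rho> * \<zeta>)) = Re (cnj \<zeta> * cis (pi / d) * (of_real \<rho> * \<zeta>))"
      unfolding R C by simp
    show "\<forall>\<mu>. \<mu> ^ d = - 1 \<longrightarrow>
      Re (\<mu> * (of_real \<rho> * \<zeta>)) \<le> Re (cnj \<zeta> * cis (pi / d) * (of_real \<rho> * \<zeta>))"
    proof (intro allI impI)
      fix \<mu> :: complex assume "\<mu> ^ d = - 1"
      then have "(\<mu> * \<zeta>) ^ d = - 1" using \<zeta> by (simp add: power_mult_distrib)
      then have "Re (\<mu> * \<zeta>) \<le> cos (pi / d)" by (rule Re_root_minus_one_le[OF d0])
      then show "Re (\<mu> * (of_real \<rho> * \<zeta>)) \<le> Re (cnj \<zeta> * cis (pi / d) * (of_real \<rho> * \<zeta>))"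
        unfolding R C using \<rho> by (rule mult_left_mono)
    qed
  qed
qed

text \<open>Equal moduli and equal real parts force \<open>\<eta>' * z = cnj (\<eta> * z)\<close>, so \<open>z ^ d\<close> is real; if it were
  negative, the direction of \<open>cnj z\<close> would be a better choice than \<open>\<eta>\<close>.\<close>
lemma two_maximal_roots_imp_real_power:
  assumes d: "0 < d" and \<eta>: "\<eta> ^ d = - 1" "\<eta>' ^ d = - 1" "\<eta> \<noteq> \<eta>'"
    and eq: "Re (\<eta>' * z) = Re (\<eta> * z)"
    and max: "\<And>\<mu>. \<mu> ^ d = - 1 \<Longrightarrow> Re (\<mu> * z) \<le> Re (\<eta> * z)"
  obtains \<rho> \<zeta> where "0 \<le> \<rho>" "\<zeta> ^ d = 1" "z = of_real \<rho> * \<zeta>"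
proof (cases "z = 0")
  case True
  then show thesis by (intro that[of 0 1]) auto
next
  case False
  define r where "r = cmod z"
  have r: "0 < r" using False by (simp add: r_def)
  have zz: "z * cnj z = (of_real r)\<^sup>2" 
    unfolding r_def of_real_power[symmetric] by (rule complex_norm_square[symmetric])
  have n: "cmod (\<eta> * z) = r" "cmod (\<eta>' * z) = r"
    using cmod_eq_1_of_power[OF d] \<eta> by (auto simp: norm_mult r_def)
  have "(Im (\<eta>' * z))\<^sup>2 = (Im (\<eta> * z))\<^sup>2"
    using n eq cmod_power2[of "\<eta> * z"] cmod_power2[of "\<eta>' * z"] by simp
  moreover have "\<eta>' * z \<noteq> \<eta> * z" using False \<eta> by simp
  ultimately have cj: "\<eta>' * z = cnj (\<eta> * z)"
    using eq by (auto simp: power2_eq_iff complex_eq_iff simp del: times_complex.sel complex_cnj_mult)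
  have "(\<eta>' * z) ^ d = (cnj (\<eta> * z)) ^ d" using cj by simp
  then have zd: "z ^ d = cnj (z ^ d)"
    using \<eta> by (simp add: power_mult_distrib flip: complex_cnj_power)
  define \<zeta> where "\<zeta> = z / of_real r"
  have z: "z = of_real r * \<zeta>" using r by (simp add: \<zeta>_def)
  have "\<zeta> ^ d = cnj (\<zeta> ^ d)" using zd r by (simp add: \<zeta>_def power_divide)
  moreover have "cmod (\<zeta> ^ d) = 1" using r by (simp add: \<zeta>_def norm_power norm_divide r_def)
  ultimately have "\<zeta> ^ d = 1 \<or> \<zeta> ^ d = - 1"
    by (metis (no_types, lifting) complex_cnj_cancel_iff complex_norm_square mult.commute of_real_1 one_power2 power2_eq_1_iff power2_eq_square)
  then show thesis
  proof
    assume "\<zeta> ^ d = 1"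
    then show thesis using r z by (intro that[of r \<zeta>]) auto
  next
    assume "\<zeta> ^ d = - 1"
    then have "(cnj \<zeta>) ^ d = - 1" by (simp flip: complex_cnj_power)
    from max[OF this] have "r \<le> Re (\<eta> * z)"
    proof -
      have "cnj \<zeta> * z = of_real r" using zz r by (simp add: \<zeta>_def power2_eq_square mult.commute field_simps)
      then show ?thesis using \<open>Re (cnj \<zeta> * z) \<le> Re (\<eta> * z)\<close> by simp
    qed
    \<comment> \<open>Now \<open>\<eta> * z\<close> is real, hence equal to its conjugate
      \<open>\<eta>' * z\<close>, against \<open>\<eta> \<noteq> \<eta>'\<close>.\<close>
    then have "Re (\<eta> * z) = cmod (\<eta> * z)" using n complex_Re_le_cmod[of "\<eta> * z"] by simp
    then have "Im (\<eta> * z) = 0" using cmod_power2[of "\<eta> * z"] by simp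
    then have "\<eta>' * z = \<eta> * z" unfolding cj by (simp only: complex_eq_iff complex_cnj) simp
    then show thesis using False \<eta> by simp
  qed
qed

section \<open>The twisted join in coordinates\<close>

lemma unit_roots_join_eq:
  assumes d: "0 < d"
  shows "unit_roots_join d = {(\<alpha> * of_real (cos \<phi>), \<beta> * of_real (sin \<phi>)) | \<alpha> \<beta> \<phi>.
    \<alpha> ^ d = 1 \<and> \<beta> ^ d = 1 \<and> 0 \<le> \<phi> \<and> \<phi> \<le> pi / 2}"
proof -
  define \<xi> :: complex where "\<xi> = exp (2 * of_real pi * \<i> / of_nat d)"
  have xi: "\<xi> ^ k = exp (2 * of_real pi * \<i> * of_nat k / of_nat d)" for k
    by (simp add: \<xi>_def mult_ac flip: exp_of_nat_mult)
  have roots: "\<alpha> ^ d = 1 \<longleftrightarrow> (\<exists>k<d. \<alpha> = \<xi> ^ k)" for \<alpha>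
    using complex_roots_unity[of d] d unfolding xi by auto
  show ?thesis
    unfolding unit_roots_join_def \<xi>_def[symmetric] roots by blast
qed

lemma induced_twist_image:
  assumes "0 < d"
  shows "induced_twist ` twisted_product d A = twist ` (A \<times> sphere 0 1)"
proof -
  have "twisted_product d A = (\<lambda>p. diagonal_orbit_rel d A `` {p}) ` (A \<times> sphere 0 1)"
    by (auto simp: twisted_product_def quotient_def)
  then have "induced_twist ` twisted_product d A
      = (\<lambda>p. induced_twist (diagonal_orbit_rel d A `` {p})) ` (A \<times> sphere 0 1)"
    by (simp only: image_image)
  also have "\<dots> = twist ` (A \<times> sphere 0 1)"
    by (rule image_cong[OF refl]) (use induced_twist_class[OF assms] in force)
  finally show ?thesis .
qed

text \<open>The product \<open>fst q * cnj (snd q)\<close> is unchanged by unit scalars, and on the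
  join it is \<open>cos \<phi> * sin \<phi>\<close> times a root of unity. Conversely, the moduli of
  the coordinates of q determine \<phi>, and \<zeta> serves as their relative phase.\<close>

lemma twisted_join_iff:
  assumes d: "0 < d"
  shows "q \<in> induced_twist ` twisted_product d (unit_roots_join d) \<longleftrightarrow>
    q \<in> S3 \<and> (\<exists>\<rho> \<zeta>. 0 \<le> \<rho> \<and> \<zeta> ^ d = 1 \<and> fst q * cnj (snd q) = of_real \<rho> * \<zeta>)"
    (is "_ \<longleftrightarrow> ?R")
  unfolding induced_twist_image[OF d]
proof
  assume "q \<in> twist ` (unit_roots_join d \<times> sphere 0 1)"
  then obtain \<alpha> \<beta> \<phi> w where a: "\<alpha> ^ d = 1" and b: "\<beta> ^ d = 1" and \<phi>: "0 \<le> \<phi>" "\<phi> \<le> pi / 2"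
    and w: "cmod w = 1" and q: "q = (inverse w * (\<alpha> * of_real (cos \<phi>)), inverse w * (\<beta> * of_real (sin \<phi>)))"
    by (auto simp: unit_roots_join_eq[OF d] twist_def scal_def)
  have n: "cmod \<alpha> = 1" "cmod \<beta> = 1" using a b cmod_eq_1_of_power[OF d] by blast+
  have q3: "q \<in> S3" using n w by (simp add: mem_S3_iff q norm_mult norm_inverse)
  have "inverse w * cnj (inverse w) = 1"
    unfolding complex_norm_square[symmetric] using w by (simp add: norm_inverse)
  moreover have "fst q * cnj (snd q) = (inverse w * cnj (inverse w)) * (of_real (cos \<phi> * sin \<phi>) * (\<alpha> * cnj \<beta>))"
    by (simp add: q)
  ultimately have "fst q * cnj (snd q) = of_real (cos \<phi> * sin \<phi>) * (\<alpha> * cnj \<beta>)" by simp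
  moreover have "0 \<le> cos \<phi> * sin \<phi>"
    using \<phi> by (intro mult_nonneg_nonneg cos_ge_zero sin_ge_zero) auto
  moreover have "(\<alpha> * cnj \<beta>) ^ d = 1"
    using a b by (simp add: power_mult_distrib flip: complex_cnj_power)
  ultimately show ?R using q3 by blast
next
  assume R: ?R
  then obtain \<rho> \<zeta> where \<rho>: "0 \<le> \<rho>" and \<zeta>: "\<zeta> ^ d = 1" and z: "fst q * cnj (snd q) = of_real \<rho> * \<zeta>"
    by blast
  have q: "(cmod (fst q))\<^sup>2 + (cmod (snd q))\<^sup>2 = 1" using R by (simp add: mem_S3_iff)
  \<comment> \<open>Take for a the phase of \<open>snd q\<close>, so that the second root of unity
    can be 1; if \<open>snd q\<close> is 0, the phase of \<open>fst q\<close> serves.\<close>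
  have "\<exists>a \<alpha>. cmod a = 1 \<and> \<alpha> ^ d = 1 \<and> fst q = a * (\<alpha> * of_real (cmod (fst q))) \<and> snd q = a * of_real (cmod (snd q))"
  proof (cases "snd q = 0")
    case True
    then have "cmod (fst q) = 1" using q norm_ge_zero[of "fst q"] by (auto simp: power2_eq_1_iff simp del: norm_ge_zero)
    then show ?thesis using True by (intro exI[of _ "fst q"] exI[of _ 1]) auto
  next
    case False
    define a where "a = sgn (snd q)"
    have a: "cmod a = 1" using False by (simp add: a_def norm_sgn)
    have sq: "snd q = a * of_real (cmod (snd q))" using False by (simp add: a_def sgn_eq)
    have "cmod \<zeta> = 1" using \<zeta> d cmod_eq_1_of_power by blast
    then have \<rho>': "\<rho> = cmod (fst q) * cmod (snd q)"
      using arg_cong[OF z, of cmod] \<rho> by (simp add: norm_mult)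
    have "fst q * (snd q * cnj (snd q)) = snd q * (of_real \<rho> * \<zeta>)"
      by (simp flip: z)
    then have "fst q * of_real ((cmod (snd q))\<^sup>2) = snd q * (of_real \<rho> * \<zeta>)"
      by (simp only: complex_norm_square)
    also have "\<dots> = (a * (\<zeta> * of_real (cmod (fst q)))) * of_real ((cmod (snd q))\<^sup>2)"
      by (subst sq) (simp add: \<rho>' power2_eq_square)
    finally have "fst q = a * (\<zeta> * of_real (cmod (fst q)))" using False by simp
    then show ?thesis using a sq \<zeta> by blast
  qed
  then obtain a \<alpha> where a: "cmod a = 1" "\<alpha> ^ d = 1" "fst q = a * (\<alpha> * of_real (cmod (fst q)))"
    "snd q = a * of_real (cmod (snd q))" by blast
  define \<phi> where "\<phi> = arccos (cmod (fst q))"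
  have f1: "cmod (fst q) \<le> 1"
  proof -
    have "(cmod (fst q))\<^sup>2 \<le> 1" using q zero_le_power2[of "cmod (snd q)"] by linarith
    then show ?thesis by (simp add: abs_square_le_1)
  qed
  have c: "cos \<phi> = cmod (fst q)" using f1 by (simp add: \<phi>_def cos_arccos_abs)
  have \<phi>: "0 \<le> \<phi>" "\<phi> \<le> pi / 2"
    using f1 arccos_le_pi2[of "cmod (fst q)"] order_trans[of "- 1" 0 "cmod (fst q)"]
    by (simp_all add: \<phi>_def arccos_lbound)
  have "0 \<le> sin \<phi>" using \<phi> by (intro sin_ge_zero) auto
  moreover have "(sin \<phi>)\<^sup>2 = (cmod (snd q))\<^sup>2" using q by (simp add: sin_squared_eq c)
  ultimately have s: "sin \<phi> = cmod (snd q)" by (metis norm_ge_zero power2_eq_imp_eq)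
  \<comment> \<open>\<open>twist\<close> scales by the inverse of its second argument, hence the
    witness \<open>inverse a\<close>.\<close>
  have "q = twist ((\<alpha> * of_real (cos \<phi>), 1 * of_real (sin \<phi>)), inverse a)"
    using a by (simp add: twist_def scal_def c s prod_eq_iff)
  moreover have "(\<alpha> * of_real (cos \<phi>), 1 * of_real (sin \<phi>)) \<in> unit_roots_join d"
    unfolding unit_roots_join_eq[OF d] using a(2) \<phi>
    by (intro CollectI exI[of _ \<alpha>] exI[of _ "1 :: complex"] exI[of _ \<phi>]) simp
  moreover have "inverse a \<in> sphere 0 1" using a by (simp add: norm_inverse)
  ultimately show "q \<in> twist ` (unit_roots_join d \<times> sphere 0 1)" by blast
qed

section \<open>The cut locus of the link\<close>

lemma herm_great_circle:
  "herm x (great_circle p v t) = of_real (cos t) * herm x p + of_real (sin t) * herm x v"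
  by (simp add: herm_def great_circle_def scaleR_conv_of_real algebra_simps)

text \<open>\<open>two_maximal_roots\<close> supplies two circles of the link tied for nearest to q.
  Their nearest points have different ratios, hence differ, and
  \<open>two_nearest_points_imp_cut\<close> applies.\<close>

lemma twisted_join_subset_cut_locus:
  assumes d: "2 \<le> d" and q: "q \<in> S3"
    and \<rho>: "0 \<le> \<rho>" and \<zeta>: "\<zeta> ^ d = 1" and z: "fst q * cnj (snd q) = of_real \<rho> * \<zeta>"
  shows "q \<in> cut_locus S3 (fermat_link d)"
proof -
  have d0: "0 < d" using d by simp
  obtain \<eta> \<eta>' where \<eta>: "\<eta> ^ d = - 1" "\<eta>' ^ d = - 1" "\<eta> \<noteq> \<eta>'"
    "Re (\<eta>' * (of_real \<rho> * \<zeta>)) = Re (\<eta> * (of_real \<rho> * \<zeta>))"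
    and max: "\<forall>\<mu>. \<mu> ^ d = - 1 \<longrightarrow> Re (\<mu> * (of_real \<rho> * \<zeta>)) \<le> Re (\<eta> * (of_real \<rho> * \<zeta>))"
    by (rule two_maximal_roots[OF d \<rho> \<zeta>])
  obtain x where x: "x \<in> fermat_link d" "ratio x = \<eta>" "x \<bullet> q = cmod (herm x q)"
    by (rule ex_fermat_link_ratio[OF d0 \<eta>(1)])
  obtain x' where x': "x' \<in> fermat_link d" "ratio x' = \<eta>'" "x' \<bullet> q = cmod (herm x' q)"
    by (rule ex_fermat_link_ratio[OF d0 \<eta>(2)])
  note H = cmod_herm_fermat_link[OF d0 _ q, unfolded z]
  have "y \<bullet> q \<le> x \<bullet> q" if y: "y \<in> fermat_link d" for y
  proof -
    have "(cmod (herm y q))\<^sup>2 \<le> (cmod (herm x q))\<^sup>2"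
      using max[rule_format, OF fermat_link_coords(3)[OF d0 y]] by (simp add: H y x)
    then have "cmod (herm y q) \<le> cmod (herm x q)" by simp
    then show ?thesis
      using complex_Re_le_cmod[of "herm y q"] by (simp add: x(3) inner_eq_Re_herm[of y])
  qed
  moreover have "x' \<bullet> q = x \<bullet> q"
  proof -
    have "(cmod (herm x' q))\<^sup>2 = (cmod (herm x q))\<^sup>2"
      using \<eta>(4) by (simp add: H x x')
    then show ?thesis by (simp add: x(3) x'(3))
  qed
  moreover have "x \<noteq> x'" using x(2) x'(2) \<eta>(3) by auto
  ultimately show ?thesis
    using q x(1) x'(1) unfolding S3_def
    by (intro two_nearest_points_imp_cut[of _ _ x x']) (auto simp: fermat_link_def S3_def)
qed

text \<open>If the nearest circle of the link is unique at \<open>q\<close>, it stays so, by continuity and since there are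
  only finitely many circles, slightly beyond \<open>q\<close>; there the foot point on it is still nearest because
  \<open>e\<close> leaves the circle orthogonally.\<close>
lemma extend_past_unique_nearest:
  assumes d: "2 \<le> d" and q: "q \<in> S3" and l: "0 \<le> l" "l \<le> pi"
    and x: "x \<in> fermat_link d" and xq: "x \<bullet> q = cos l"
    and max: "\<And>y. y \<in> fermat_link d \<Longrightarrow> y \<bullet> q \<le> cos l"
    and e: "e = great_circle x v" "norm v = 1" "herm x v = 0" "e l = q"
    and uniq: "\<And>\<eta>. \<eta> ^ d = - 1 \<Longrightarrow> \<eta> \<noteq> ratio x \<Longrightarrow>
      Re (\<eta> * (fst q * cnj (snd q))) < Re (ratio x * (fst q * cnj (snd q)))"
  obtains m where "l < m" "m \<le> pi" "\<And>y. y \<in> fermat_link d \<Longrightarrow> y \<bullet> e m \<le> cos m"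
proof -
  have d0: "0 < d" using d by simp
  define Z where "Z t = fst (e t) * cnj (snd (e t))" for t
  have nx: "norm x = 1" using x by (auto simp: fermat_link_def S3_def)
  have xv: "x \<bullet> v = 0" using e(3) by (simp add: inner_eq_Re_herm)
  have xx: "herm x x = 1" using x by (auto simp: fermat_link_def herm_self)
  have eS: "e t \<in> S3" for t using norm_great_circle[OF nx e(2) xv] by (simp add: S3_def e(1))
  \<comment> \<open>As v is Hermitian-orthogonal to x, \<open>herm x (e t)\<close> is
    \<open>cos t\<close> for every t; so x stays nearest on its own circle while the cosine is
    nonnegative.\<close>
  have he: "(cos t)\<^sup>2 = 1 / 2 + Re (ratio x * Z t)" for t
    using cmod_herm_fermat_link[OF d0 x eS[of t]]
    by (simp add: e(1) herm_great_circle xx e(3) Z_def)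
  have Zl: "Z l = fst q * cnj (snd q)" by (simp add: Z_def e(4))
  have cl: "0 \<le> cos l" using herm_nearest(2)[OF x, of q] max xq by simp
  \<comment> \<open>Some other circle of the link is strictly farther from q by \<open>uniq\<close>;
    its squared cosine is nonnegative, so \<open>(cos l)\<^sup>2\<close> is positive.\<close>
  have "0 < cos l"
  proof -
    \<comment> \<open>With \<rho> = 0 and \<zeta> = 1, \<open>two_maximal_roots\<close> serves only
      to provide two distinct roots of -1, one of which is not \<open>ratio x\<close>.\<close>
    obtain \<alpha> \<beta> :: complex where "\<alpha> ^ d = - 1" "\<beta> ^ d = - 1" "\<alpha> \<noteq> \<beta>"
      by (rule two_maximal_roots[OF d order_refl power_one]) (rule that)
    then obtain \<eta> where \<eta>: "\<eta> ^ d = - 1" "\<eta> \<noteq> ratio x" by metis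
    obtain y where y: "y \<in> fermat_link d" "ratio y = \<eta>" by (rule ex_fermat_link_ratio[OF d0 \<eta>(1)])
    have "0 \<le> 1 / 2 + Re (\<eta> * Z l)"
      unfolding Zl y(2)[symmetric] cmod_herm_fermat_link[OF d0 y(1) q, symmetric] by simp
    also have "\<dots> < (cos l)\<^sup>2" using uniq[OF \<eta>] unfolding he[of l] Zl by simp
    finally have "cos l \<noteq> 0" by simp
    then show ?thesis using cl by simp
  qed
  define R where "R = {\<eta>::complex. \<eta> ^ d = - 1 \<and> \<eta> \<noteq> ratio x}"
  have "finite R" unfolding R_def using finite_nth_roots[OF d0, of "- 1"] by (rule rev_finite_subset) auto
  have "isCont Z l" unfolding Z_def[abs_def] e(1) great_circle_def by (intro continuous_intros)
  then have lim: "(Z \<longlongrightarrow> Z l) (at_right l)" by (simp add: isCont_def filterlim_at_split)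
  have limc: "(cos \<longlongrightarrow> cos l) (at_right l)" by (rule tendsto_cos[OF tendsto_ident_at])
  have "\<forall>\<^sub>F t in at_right l. \<forall>\<eta>\<in>R. Re (\<eta> * Z t) < Re (ratio x * Z t)"
  proof (intro eventually_ball_finite[OF \<open>finite R\<close>] ballI)
    fix \<eta> assume "\<eta> \<in> R"
    then have pos: "0 < Re (ratio x * Z l) - Re (\<eta> * Z l)" using uniq by (simp add: R_def Zl)
    have "((\<lambda>t. Re (ratio x * Z t) - Re (\<eta> * Z t)) \<longlongrightarrow> Re (ratio x * Z l) - Re (\<eta> * Z l)) (at_right l)"
      by (intro tendsto_diff tendsto_Re tendsto_mult tendsto_const lim)
    from order_tendstoD(1)[OF this pos]
    have "\<forall>\<^sub>F t in at_right l. 0 < Re (ratio x * Z t) - Re (\<eta> * Z t)" .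
    then show "\<forall>\<^sub>F t in at_right l. Re (\<eta> * Z t) < Re (ratio x * Z t)"
      by (rule eventually_mono) simp
  qed
  moreover have "\<forall>\<^sub>F t in at_right l. 0 < cos t"
    using order_tendstoD(1)[OF limc \<open>0 < cos l\<close>] .
  moreover have "l < pi" using \<open>0 < cos l\<close> l by (cases "l = pi") auto
  then have "\<forall>\<^sub>F t in at_right l. l < t \<and> t < pi"
    using eventually_at_right_real[of l pi] by simp
  ultimately have "\<forall>\<^sub>F t in at_right l. (\<forall>\<eta>\<in>R. Re (\<eta> * Z t) < Re (ratio x * Z t)) \<and> 0 < cos t \<and> l < t \<and> t < pi"
    by (simp add: eventually_conj_iff)
  from eventually_happens'[OF trivial_limit_at_right_real this]
  obtain m where m: "\<And>\<eta>. \<eta> \<in> R \<Longrightarrow> Re (\<eta> * Z m) < Re (ratio x * Z m)" "0 < cos m" "l < m" "m < pi"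
    by blast
  show thesis
  proof (rule that[of m])
    fix y assume y: "y \<in> fermat_link d"
    have "Re (ratio y * Z m) \<le> Re (ratio x * Z m)"
    proof (cases "ratio y = ratio x")
      case False
      then have "ratio y \<in> R" using fermat_link_coords(3)[OF d0 y] by (simp add: R_def)
      then show ?thesis using m(1) by (simp add: less_imp_le)
    qed simp
    then have "(cmod (herm y (e m)))\<^sup>2 \<le> (cos m)\<^sup>2"
      unfolding cmod_herm_fermat_link[OF d0 y eS] he Z_def by simp
    then have "cmod (herm y (e m)) \<le> cos m" by (rule power2_le_imp_le) (use m(2) in simp)
    then show "y \<bullet> e m \<le> cos m"
      using complex_Re_le_cmod[of "herm y (e m)"] by (simp add: inner_eq_Re_herm)
  qed (use m(3,4) in simp_all)
qed

text \<open>Off the twisted join, \<open>two_maximal_roots_imp_real_power\<close> rules out a tie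
  between maximal roots, and then \<open>extend_past_unique_nearest\<close> prolongs the given
  minimal geodesic beyond q.\<close>

lemma cut_locus_subset_twisted_join:
  assumes d: "2 \<le> d" and q: "q \<in> cut_locus S3 (fermat_link d)"
  obtains \<rho> \<zeta> where "0 \<le> \<rho>" "\<zeta> ^ d = 1" "fst q * cnj (snd q) = of_real \<rho> * \<zeta>"
proof (rule ccontr)
  assume neg: "\<not> thesis"
  note witness = that
  have d0: "0 < d" using d by simp
  have N: "fermat_link d \<subseteq> sphere 0 1" by (auto simp: fermat_link_def S3_def)
  have dim: "2 \<le> DIM(complex \<times> complex)" by simp
  note min_iff = dist_minimal_geodesic_sphere_iff[OF dim N, folded S3_def]
  obtain c l where qS: "q \<in> S3" and cl: "dist_minimal_geodesic S3 (fermat_link d) q c l"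
    and ext: "\<And>e m. l < m \<Longrightarrow> geodesic S3 e m \<Longrightarrow> \<forall>t\<in>{0..l}. e t = c t \<Longrightarrow>
      \<not> dist_minimal_geodesic S3 (fermat_link d) (e m) e m"
    using q unfolding cut_locus_def by blast
  define x where "x = c 0"
  have c: "geodesic S3 c l" "x \<in> fermat_link d" "c l = q" "l \<le> pi"
    and max: "\<And>y. y \<in> fermat_link d \<Longrightarrow> y \<bullet> q \<le> cos l"
    using cl by (auto simp: min_iff x_def)
  have l: "0 \<le> l" using c(1) by (simp add: geodesic_def)
  have nx: "norm x = 1" using c(2) N by auto
  obtain v where v: "norm v = 1" "x \<bullet> v = 0" "\<And>t. t \<in> {0..l} \<Longrightarrow> c t = great_circle x v t"
    using geodesic_sphere_great_circle[OF dim c(1)[unfolded S3_def]] unfolding x_def by blast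
  have qv: "great_circle x v l = q" using v(3)[of l] l c(3) by simp
  have xq: "x \<bullet> q = cos l" using nx v(2) by (simp add: inner_great_circle norm_eq_1 flip: qv)
  have hq: "herm x q = of_real (cos l)" "0 \<le> cos l"
    using herm_nearest[OF c(2), of q] max xq by auto
  \<comment> \<open>The arc must leave the Hopf circle of x orthogonally. For l > 0 this follows
    from \<open>herm x q\<close> being equal to \<open>cos l\<close>; for l = 0 the arc has no
    direction of its own and a suitable one is chosen.\<close>
  have "\<exists>v. norm v = 1 \<and> herm x v = 0 \<and> (\<forall>t\<in>{0..l}. c t = great_circle x v t)"
  proof (cases "l = 0")
    case True
    have "norm (- cnj (snd x), cnj (fst x)) = 1"
      using nx by (simp add: norm_prod_def add.commute)
    then show ?thesis using True
      by (intro exI[of _ "(- cnj (snd x), cnj (fst x))"]) (auto simp: herm_def x_def mult.commute)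
  next
    case False
    have "l \<noteq> pi" using hq(2) by auto
    then have "0 < sin l" using False l c(4) by (intro sin_gt_zero) auto
    moreover have "herm x x = 1"
      using c(2) by (auto simp: fermat_link_def herm_self)
    then have "of_real (sin l) * herm x v = 0"
      using hq(1) by (simp add: herm_great_circle flip: qv)
    ultimately show ?thesis using v by (intro exI[of _ v]) simp
  qed
  then obtain v where v: "norm v = 1" "herm x v = 0" "\<And>t. t \<in> {0..l} \<Longrightarrow> c t = great_circle x v t"
    by blast
  have qv: "great_circle x v l = q" using v(3)[of l] l c(3) by simp
  have "Re (\<eta> * (fst q * cnj (snd q))) < Re (ratio x * (fst q * cnj (snd q)))"
    if \<eta>: "\<eta> ^ d = - 1" "\<eta> \<noteq> ratio x" for \<eta>
  proof -
    have le: "Re (\<mu> * (fst q * cnj (snd q))) \<le> Re (ratio x * (fst q * cnj (snd q)))" if "\<mu> ^ d = - 1" for \<mu>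
      using max xq that by (intro ratio_nearest[OF d0 c(2) qS]) auto
    moreover have "Re (\<eta> * (fst q * cnj (snd q))) \<noteq> Re (ratio x * (fst q * cnj (snd q)))"
    proof
      assume eq: "Re (\<eta> * (fst q * cnj (snd q))) = Re (ratio x * (fst q * cnj (snd q)))"
      show False
        by (rule two_maximal_roots_imp_real_power[OF d0 fermat_link_coords(3)[OF d0 c(2)] \<eta>(1) \<eta>(2)[symmetric] eq le])
           (assumption, use neg witness in blast)
    qed
    ultimately show ?thesis using \<eta>(1) by (simp add: less_le)
  qed
  then obtain m where m: "l < m" "m \<le> pi" "\<And>y. y \<in> fermat_link d \<Longrightarrow> y \<bullet> great_circle x v m \<le> cos m"
    using extend_past_unique_nearest[OF d qS l c(4) c(2) xq max refl v(1,2) qv] by blast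
  have "geodesic S3 (great_circle x v) m"
    unfolding S3_def using m(1) l v nx by (intro geodesic_great_circle) (auto simp: inner_eq_Re_herm)
  moreover from this have "dist_minimal_geodesic S3 (fermat_link d) (great_circle x v m) (great_circle x v) m"
    using m c(2) by (simp add: min_iff)
  ultimately show False using ext[of m "great_circle x v"] m(1) v(3) by simp
qed

text \<open>For d = 1 the link is a single great circle, whose cut locus is the great circle of
  points with equal coordinates, strictly smaller than the twisted join. From d = 2 on there are
  several circles, and both inclusions go through \<open>twisted_join_iff\<close>.\<close>

theorem theorem6p3p2:
  fixes d :: nat
  assumes "d \<ge> 2"
  shows "cut_locus S3 (fermat_link d) = induced_twist ` twisted_product d (unit_roots_join d)"
proof (intro set_eqI iffI)
  have d0: "0 < d" using assms by simp
  fix q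
  show "q \<in> induced_twist ` twisted_product d (unit_roots_join d)" if q: "q \<in> cut_locus S3 (fermat_link d)"
  proof -
    obtain \<rho> \<zeta> where "0 \<le> \<rho>" "\<zeta> ^ d = 1" "fst q * cnj (snd q) = of_real \<rho> * \<zeta>"
      by (rule cut_locus_subset_twisted_join[OF assms q])
    moreover have "q \<in> S3" using q by (simp add: cut_locus_def)
    ultimately show ?thesis unfolding twisted_join_iff[OF d0] by blast
  qed
  show "q \<in> cut_locus S3 (fermat_link d)" if "q \<in> induced_twist ` twisted_product d (unit_roots_join d)"
    using that twisted_join_subset_cut_locus[OF assms] unfolding twisted_join_iff[OF d0] by blast
qed

end
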